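(* There is an algorithm running in time polynomial in $n$ which, given two compatible strings $X,Y$ of length $n$ with all symbols drawn from $\{0,1,\dots,n-1\}$, computes two compatible binary strings $x,y$ of length polynomial in $n$ such that $D(X,Y)=d(x,y)$.
   Context: The prefix reversal (flip) $f^{(i)}$ applied to a string $s=s_1\cdots s_m$ ($1\le i\le m$) yields $s_i s_{i-1}\cdots s_1 s_{i+1}\cdots s_m$. Two strings are \emph{compatible} if each symbol occurs the same number of times in both. For compatible strings $X,Y$ over an arbitrary alphabet (symbols may repeat), $D(X,Y)$ denotes the minimum number of prefix reversals transforming $X$ into $Y$; for compatible binary strings $x,y$ (words over $\{0,1\}$) this minimum is denoted $d(x,y)$. *)

theory Defs
  imports Main "HOL-Library.Multiset"
begin

definition flip :: "nat \<Rightarrow> 'a list \<Rightarrow> 'a list" where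
  "flip i s = rev (take i s) @ drop i s"

definition compatible :: "'a list \<Rightarrow> 'a list \<Rightarrow> bool" where
  "compatible X Y \<longleftrightarrow> mset X = mset Y"

definition D :: "nat list \<Rightarrow> nat list \<Rightarrow> nat" where
  "D X Y = (LEAST k. \<exists>is. length is = k \<and> (\<forall>i\<in>set is. 1 \<le> i \<and> i \<le> length X)
                          \<and> fold flip is X = Y)"

definition binary :: "nat list \<Rightarrow> bool" where
  "binary x \<longleftrightarrow> set x \<subseteq> {0, 1}"

text \<open>The same distance, for binary strings.\<close>
definition d :: "nat list \<Rightarrow> nat list \<Rightarrow> nat" where
  "d x y = D x y"

text \<open>Tape symbols are naturals, 0 is the blank. States are naturals, 0 is the start
  state and 1 the (absorbing) halting state. Moves are -1, 0, 1.\<close>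
record tm =
  nstates :: nat
  nsyms :: nat
  delta :: "nat \<Rightarrow> nat \<Rightarrow> nat \<times> nat \<times> int"

definition wf_tm :: "tm \<Rightarrow> bool" where
  "wf_tm M \<longleftrightarrow> 2 \<le> nstates M \<and> 5 \<le> nsyms M \<and>
     (\<forall>q < nstates M. \<forall>s < nsyms M. case delta M q s of (q', s', m) \<Rightarrow>
        q' < nstates M \<and> s' < nsyms M \<and> m \<in> {-1, 0, 1})"

type_synonym config = "nat \<times> (int \<Rightarrow> nat) \<times> int"

definition tm_step :: "tm \<Rightarrow> config \<Rightarrow> config" where
  "tm_step M c = (case c of (q, t, h) \<Rightarrow>
     if q = 1 then (q, t, h)
     else (case delta M q (t h) of (q', s', m) \<Rightarrow> (q', t(h := s'), h + m)))"

definition tm_run :: "tm \<Rightarrow> nat \<Rightarrow> config \<Rightarrow> config" where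
  "tm_run M k c = (tm_step M ^^ k) c"

definition tape_of :: "nat list \<Rightarrow> int \<Rightarrow> nat" where
  "tape_of w = (\<lambda>i. if 0 \<le> i \<and> nat i < length w then w ! nat i else 0)"

definition init_config :: "nat list \<Rightarrow> config" where
  "init_config w = (0, tape_of w, 0)"

definition halts_with :: "tm \<Rightarrow> nat list \<Rightarrow> nat \<Rightarrow> nat list \<Rightarrow> bool" where
  "halts_with M w k out \<longleftrightarrow>
     fst (tm_run M k (init_config w)) = 1 \<and> fst (snd (tm_run M k (init_config w))) = tape_of out"

definition enc_sym_string :: "nat list \<Rightarrow> nat list" where
  "enc_sym_string X = concat (map (\<lambda>a. replicate (a + 1) 2 @ [3]) X)"

definition enc_input :: "nat list \<Rightarrow> nat list \<Rightarrow> nat list" where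
  "enc_input X Y = enc_sym_string X @ [4] @ enc_sym_string Y"

definition enc_bin_string :: "nat list \<Rightarrow> nat list" where
  "enc_bin_string x = map Suc x"

definition enc_output :: "nat list \<Rightarrow> nat list \<Rightarrow> nat list" where
  "enc_output x y = enc_bin_string x @ [4] @ enc_bin_string y"

end

theory Submission
  imports Defs
begin

text \<open>
  Let L be the length of the encoded input and N = L + 1. The symbol a is coded by N runs of
  a + 1 ones, each followed by a zero. A flip of X lifts to the flip of the binary string that
  stops just before a zero, so d x y \<le> D X Y. Conversely, regard a binary string as the list of
  its (possibly empty) runs of ones: a flip reverses a prefix of this list and changes the length
  of at most two runs. So a sequence of k flips leaves all but 2k runs intact, and as
  2k \<le> 2 D X Y \<le> 4n < N, Hall's theorem provides a bijection between the blocks of x and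
  those of y, together with one intact run travelling from each block to its partner. Deleting
  everything else turns the flips of x into at most k flips taking X to Y.

  The Turing machine first moves its input to the left of the origin, then copies each block N
  times to the right of the origin, using the moved input itself as a counter.
\<close>

subsection \<open>Sequences of flips\<close>

text \<open>With a single run per symbol, binary flips would not have to respect the symbols: a flip
  may stop inside a run and so trade ones between runs. Repetition makes this harmless. A set of s
  blocks of \<open>x\<close> holds s * N runs, fewer than N of them are lost, and the others do not
  fit into fewer than s blocks of \<open>y\<close>; this is Hall's condition. The way back from runs
  to symbols rests on the fact that a flip acts on the entries kept by any deletion as a flip again.
  The number of lost runs needs a bound on the distance that does not depend on N. It comes from
  putting the symbols in place from the back, at two flips each. N only has to exceed 4n while
  staying polynomial. As every input symbol takes at least two cells, L > 4n already holds, and L +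
  1 is the number of rounds that can be counted without arithmetic by one tally mark per input cell:
  L rounds that set a mark and one that finds all of them set. The output must start at the origin,
  where the input stands, but the input serves as source and counter to the very end; hence the move
  to the left.\<close>

definition flips_within :: "nat \<Rightarrow> 'a list \<Rightarrow> 'a list \<Rightarrow> bool" where
  "flips_within k s t \<longleftrightarrow> (\<exists>is. length is \<le> k \<and> fold flip is s = t)"

lemma flips_within_refl: "flips_within k s s"
  unfolding flips_within_def by (rule exI[of _ "[]"]) simp

lemma flips_within_mono: "flips_within j s t \<Longrightarrow> j \<le> k \<Longrightarrow> flips_within k s t"
  unfolding flips_within_def using le_trans by blast

lemma flips_within_trans:
  assumes "flips_within j s t" "flips_within k t u"
  shows "flips_within (j + k) s u"
proof -
  from assms obtain xs ys where "length xs \<le> j" "fold flip xs s = t"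
    "length ys \<le> k" "fold flip ys t = u"
    unfolding flips_within_def by blast
  then show ?thesis unfolding flips_within_def
    by (intro exI[of _ "xs @ ys"]) simp
qed

lemma flips_within_flip: "flips_within 1 s (flip i s)"
  unfolding flips_within_def by (rule exI[of _ "[i]"]) simp

lemma length_flip [simp]: "length (flip i s) = length s"
  by (simp add: flip_def)

lemma mset_flip [simp]: "mset (flip i s) = mset s"
  unfolding flip_def mset_append mset_rev by (metis append_take_drop_id mset_append)

lemma map_flip: "map f (flip i s) = flip i (map f s)"
  by (simp add: flip_def rev_map take_map drop_map)

lemma flip_append: "flip (length s) (s @ t) = rev s @ t"
  by (simp add: flip_def)

text \<open>The kept entries of the flipped prefix form a prefix of the filtered list. Its length
  may be 0.\<close>

lemma filter_flip: "filter P (flip i s) = flip (length (filter P (take i s))) (filter P s)"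
proof -
  have "filter P s = filter P (take i s) @ filter P (drop i s)"
    by (metis append_take_drop_id filter_append)
  then show ?thesis by (simp add: flip_append) (simp add: flip_def rev_filter)
qed

lemma flips_within_map:
  assumes "flips_within k s t" shows "flips_within k (map f s) (map f t)"
proof -
  have "map f (fold flip is s) = fold flip is (map f s)" for "is"
    by (induction "is" arbitrary: s) (simp_all add: map_flip)
  with assms show ?thesis unfolding flips_within_def by metis
qed

lemma flips_within_filter:
  assumes "flips_within k s t" shows "flips_within k (filter P s) (filter P t)"
proof -
  have "\<exists>js. length js = length is \<and> filter P (fold flip is s) = fold flip js (filter P s)" for "is"
  proof (induction "is" arbitrary: s)
    case (Cons i "is")
    from Cons[of "flip i s"] obtain js where "length js = length is"
      "filter P (fold flip is (flip i s)) = fold flip js (filter P (flip i s))" by blast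
    then show ?case
      by (intro exI[of _ "length (filter P (take i s)) # js"]) (simp add: filter_flip)
  qed simp
  with assms show ?thesis unfolding flips_within_def by metis
qed

lemma mset_flips_within: "flips_within k s t \<Longrightarrow> mset t = mset s"
proof -
  have "mset (fold flip is s) = mset s" for "is"
    by (induction "is" arbitrary: s) simp_all
  then show "flips_within k s t \<Longrightarrow> mset t = mset s"
    unfolding flips_within_def by blast
qed

text \<open>\<open>flips_within\<close> leaves the indices free, since deletion can produce index 0,
  whereas \<open>D\<close> demands indices from 1 to the length. Indices 0 and 1 both fix the list,
  and an index beyond the end reverses all of it.\<close>

lemma flip_clamp: "s \<noteq> [] \<Longrightarrow> flip i s = flip (max 1 (min i (length s))) s"
proof (cases "i = 0")
  case True
  assume "s \<noteq> []"
  with True show ?thesis by (cases s) (simp_all add: flip_def)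
qed (auto simp: flip_def min_def max_def)

lemma fold_flip_clamp:
  assumes "s \<noteq> []"
  shows "fold flip (map (\<lambda>i. max 1 (min i (length s))) is) s = fold flip is s"
  using assms
proof (induction "is" arbitrary: s)
  case (Cons i "is")
  have "flip i s \<noteq> []" using Cons.prems by (metis length_flip length_0_conv)
  with Cons.IH[of "flip i s"] flip_clamp[OF Cons.prems, of i] show ?case by simp
qed simp

section \<open>Flip sequences and the distance \<open>D\<close>\<close>

lemma D_le:
  assumes "flips_within k s t" shows "D s t \<le> k"
proof -
  from assms obtain "is" where len: "length is \<le> k" and f: "fold flip is s = t"
    unfolding flips_within_def by blast
  have "\<exists>js. length js \<le> k \<and> (\<forall>i\<in>set js. 1 \<le> i \<and> i \<le> length s) \<and> fold flip js s = t"
  proof (cases "s = []")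
    case True
    then have "t = []" using assms mset_flips_within by fastforce
    with True show ?thesis by (intro exI[of _ "[]"]) simp
  next
    case False
    then have "1 \<le> length s" by (simp add: Suc_le_eq)
    with False show ?thesis
      by (intro exI[of _ "map (\<lambda>i. max 1 (min i (length s))) is"])
        (auto simp: fold_flip_clamp[simplified] fold_flip_clamp f len)
  qed
  then obtain js where "length js \<le> k"
    "(\<forall>i\<in>set js. 1 \<le> i \<and> i \<le> length s) \<and> fold flip js s = t" by blast
  then have "D s t \<le> length js" unfolding D_def by (intro Least_le) blast
  with \<open>length js \<le> k\<close> show ?thesis by simp
qed

text \<open>\<open>D\<close> is a least number and says something only if a sequence of flips exists
  at all; the hypothesis provides one.\<close>

lemma flips_within_D:
  assumes "flips_within k s t" shows "flips_within (D s t) s t"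
proof -
  let ?P = "\<lambda>k. \<exists>is. length is = k \<and> (\<forall>i\<in>set is. 1 \<le> i \<and> i \<le> length s) \<and> fold flip is s = t"
  from assms obtain "is" where f: "fold flip is s = t"
    unfolding flips_within_def by blast
  have "\<exists>k. ?P k"
  proof (cases "s = []")
    case True
    then have "t = []" using assms mset_flips_within by fastforce
    with True show ?thesis by (intro exI[of _ 0] exI[of _ "[]"]) simp
  next
    case False
    then have "1 \<le> length s" by (simp add: Suc_le_eq)
    with False show ?thesis
      by (intro exI exI[of _ "map (\<lambda>i. max 1 (min i (length s))) is"])
        (auto simp: fold_flip_clamp[simplified] fold_flip_clamp f)
  qed
  then have "?P (D s t)" unfolding D_def by (rule LeastI_ex)
  then obtain js where "length js = D s t" "fold flip js s = t" by blast
  then show ?thesis unfolding flips_within_def by (intro exI[of _ js]) simp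
qed

text \<open>Pancake sorting from the back: one flip brings the last target symbol to the front, a
  flip of the whole list brings it to the end, and the rest is sorted recursively.\<close>

lemma compatible_flips_within:
  assumes "mset s = mset t" shows "flips_within (2 * length t) s t"
  using assms
proof (induction t arbitrary: s rule: rev_induct)
  case Nil
  then show ?case by (simp add: flips_within_refl)
next
  case (snoc b t)
  then have "b \<in> set s" by (metis in_set_conv_decomp set_mset_mset)
  then obtain u v where s: "s = u @ b # v" by (meson split_list)
  have "flips_within 1 s (b # rev u @ v)"
    using flips_within_flip[of s "length (u @ [b])"] flip_append[of "u @ [b]" v] by (simp add: s)
  moreover have "flips_within 1 (b # rev u @ v) (rev v @ u @ [b])"
    using flips_within_flip[of "b # rev u @ v" "length (b # rev u @ v)"]
      flip_append[of "b # rev u @ v" "[]"] by simp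
  moreover have "flips_within (2 * length t) (rev v @ u @ [b]) (t @ [b])"
  proof -
    have "flips_within (2 * length t) (rev v @ u) t"
      using snoc.prems by (intro snoc.IH) (simp add: s add.commute)
    then obtain "is" where "length is \<le> 2 * length t" "fold flip is (rev v @ u) = t"
      unfolding flips_within_def by blast
    \<comment> \<open>Indices are capped at the length of the unsettled part, so that the settled
      last symbol never moves.\<close>
    moreover have "fold flip (map (min (length w)) is) (w @ [b]) = fold flip is w @ [b]" for w
    proof (induction "is" arbitrary: w)
      case (Cons i "is")
      have "flip (min (length w) i) (w @ [b]) = flip i w @ [b]"
        by (simp add: flip_def min_def)
      with Cons[of "flip i w"] show ?case by simp
    qed simp
    ultimately show ?thesis unfolding flips_within_def
      by (metis append.assoc length_map)
  qed
  ultimately have "flips_within (1 + 1 + 2 * length t) s (t @ [b])"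
    by (meson flips_within_trans)
  then show ?case by simp
qed

subsection \<open>Runs of ones\<close>

definition zero_led_runs :: "nat list \<Rightarrow> nat list" where
  "zero_led_runs R = concat (map (\<lambda>r. 0 # replicate r 1) R)"

definition zero_ended_runs :: "nat list \<Rightarrow> nat list" where
  "zero_ended_runs R = concat (map (\<lambda>r. replicate r 1 @ [0]) R)"

text \<open>The binary string whose maximal, possibly empty, runs of ones have the given lengths; the
  empty list of lengths is junk, as the empty string has the one run 0.\<close>

fun run_word :: "nat list \<Rightarrow> nat list" where
  "run_word [] = []"
| "run_word (r # R) = replicate r 1 @ zero_led_runs R"

lemma zero_led_runs_simps [simp]:
  "zero_led_runs [] = []"
  "zero_led_runs (r # R) = 0 # replicate r 1 @ zero_led_runs R"
  "zero_led_runs (R @ R') = zero_led_runs R @ zero_led_runs R'"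
  by (simp_all add: zero_led_runs_def)

lemma zero_ended_runs_simps [simp]:
  "zero_ended_runs [] = []"
  "zero_ended_runs (r # R) = replicate r 1 @ 0 # zero_ended_runs R"
  "zero_ended_runs (R @ R') = zero_ended_runs R @ zero_ended_runs R'"
  by (simp_all add: zero_ended_runs_def)

lemma rev_zero_ended_runs: "rev (zero_ended_runs R) = zero_led_runs (rev R)"
  by (induction R) simp_all

lemma run_word_snoc: "run_word (R @ [r]) = zero_ended_runs R @ replicate r 1"
proof -
  have "replicate r 1 @ zero_led_runs (R @ [r']) = zero_ended_runs (r # R) @ replicate r' 1" for r r'
    by (induction R arbitrary: r) simp_all
  then show ?thesis by (cases R) simp_all
qed

lemma rev_run_word: "rev (run_word R) = run_word (rev R)"
  by (cases R rule: rev_cases) (simp_all add: run_word_snoc rev_zero_ended_runs)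

lemma run_word_join: "run_word (R @ [r]) @ run_word (s # S) = run_word (R @ (r + s) # S)"
  by (cases R) (simp_all add: replicate_add)

text \<open>Every cut falls into exactly one run, which it splits as \<open>u + v\<close>; a cut
  right after a zero has \<open>u = 0\<close>, one right before a zero has
  \<open>v = 0\<close>.\<close>

lemma run_word_split:
  assumes "run_word R = s @ t" "R \<noteq> []"
  obtains A u v B where "R = A @ (u + v) # B" "s = run_word (A @ [u])" "t = run_word (v # B)"
proof -
  have "\<exists>A u v B. R = A @ (u + v) # B \<and> s = run_word (A @ [u]) \<and> t = run_word (v # B)"
    using assms
  proof (induction s arbitrary: R)
    case Nil
    then obtain r B where "R = r # B" by (cases R) auto
    with Nil show ?case
      by (intro exI[of _ "[]"] exI[of _ 0] exI[of _ r] exI[of _ B]) simp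
  next
    case (Cons c s)
    then obtain r B where R: "R = r # B" by (cases R) auto
    show ?case
    proof (cases r)
      case 0
      with Cons R obtain r' B' where B: "B = r' # B'" by (cases B) auto
      with Cons.prems R 0 have "run_word B = s @ t" "c = 0" by auto
      with Cons.IH[of B] B obtain A u v B'' where
        "B = A @ (u + v) # B''" "s = run_word (A @ [u])" "t = run_word (v # B'')" by auto
      with R 0 \<open>c = 0\<close> show ?thesis
        by (intro exI[of _ "0 # A"] exI[of _ u] exI[of _ v] exI[of _ B'']) (cases A; simp)
    next
      case (Suc r')
      with Cons.prems R have "run_word (r' # B) = s @ t" "c = 1" by auto
      with Cons.IH[of "r' # B"] obtain A u v B'' where
        *: "r' # B = A @ (u + v) # B''" "s = run_word (A @ [u])" "t = run_word (v # B'')" by auto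
      show ?thesis
      proof (cases A)
        case Nil
        with * R Suc \<open>c = 1\<close> show ?thesis
          by (intro exI[of _ "[]"] exI[of _ "Suc u"] exI[of _ v] exI[of _ B'']) simp
      next
        case (Cons a A')
        with * R Suc \<open>c = 1\<close> show ?thesis
          by (intro exI[of _ "Suc a # A'"] exI[of _ u] exI[of _ v] exI[of _ B'']) simp
      qed
    qed
  qed
  with that show thesis by blast
qed

lemma zero_led_runs_inject: "zero_led_runs R = zero_led_runs S \<Longrightarrow> R = S"
proof (induction R arbitrary: S)
  case Nil
  then show ?case by (cases S) auto
next
  case (Cons r R)
  then obtain s S' where S: "S = s # S'" by (cases S) auto
  have tw: "takeWhile ((=) 1) (replicate m 1 @ zero_led_runs Q) = replicate m 1" for m Q
    by (cases Q) (simp_all add: takeWhile_append)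
  from Cons.prems S have eq: "replicate r 1 @ zero_led_runs R = replicate s 1 @ zero_led_runs S'" by simp
  then have "replicate r (1::nat) = replicate s 1" using tw by metis
  then have "r = s" by (metis length_replicate)
  with eq Cons.IH S show ?case by simp
qed

lemma run_word_inject: "run_word R = run_word S \<Longrightarrow> R \<noteq> [] \<Longrightarrow> S \<noteq> [] \<Longrightarrow> R = S"
  by (rule zero_led_runs_inject) (cases R; cases S; simp)

text \<open>A cut just before a zero leaves all runs whole, and reversing a word reverses its list
  of runs.\<close>

lemma flip_run_word_prefix:
  assumes "A \<noteq> []" shows "flip (length (run_word A)) (run_word (A @ B)) = run_word (rev A @ B)"
proof -
  obtain a A' where A: "A = a # A'" using assms by (cases A) auto
  have "run_word (A @ B) = run_word A @ zero_led_runs B" using A by simp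
  moreover have "run_word (rev A @ B) = run_word (rev A) @ zero_led_runs B" using assms
    by (cases "rev A") simp_all
  ultimately show ?thesis by (simp add: flip_append rev_run_word)
qed

lemma flips_within_word:
  assumes "flips_within k R S" "R \<noteq> []" shows "flips_within k (run_word R) (run_word S)"
proof -
  have "\<exists>js. length js = length is \<and> run_word (fold flip is R) = fold flip js (run_word R)"
    if "R \<noteq> []" for "is" using that
  proof (induction "is" arbitrary: R)
    case (Cons i "is")
    have "flip i R \<noteq> []" using Cons.prems by (metis length_flip length_0_conv)
    from Cons.IH[OF this] obtain js where js: "length js = length is"
      "run_word (fold flip is (flip i R)) = fold flip js (run_word (flip i R))" by blast
    \<comment> \<open>The prefix of runs has to be nonempty, so index 0 is replaced by 1, which
      changes nothing either.\<close>
    define m where "m = max 1 (min i (length R))"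
    have "take m R \<noteq> []" using Cons.prems by (simp add: m_def)
    from flip_run_word_prefix[OF this, of "drop m R"]
    have "run_word (flip i R) = flip (length (run_word (take m R))) (run_word R)"
      using flip_clamp[OF Cons.prems, of i] unfolding m_def[symmetric] by (simp add: flip_def)
    with js show ?case
      by (intro exI[of _ "length (run_word (take m R)) # js"]) simp
  qed simp
  with assms show ?thesis unfolding flips_within_def by metis
qed

text \<open>Runs whose length has not changed so far carry the label of the run they started as, all
  other runs carry None.\<close>

definition labels :: "(nat \<times> 'a option) list \<Rightarrow> 'a list" where
  "labels T = concat (map (\<lambda>(r, x). case x of None \<Rightarrow> [] | Some l \<Rightarrow> [l]) T)"

lemma labels_simps [simp]:
  "labels [] = []" "labels ((r, None) # T) = labels T" "labels ((r, Some l) # T) = l # labels T"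
  "labels (T @ T') = labels T @ labels T'"
  by (simp_all add: labels_def)

lemma labels_rev: "labels (rev T) = rev (labels T)"
proof (induction T)
  case (Cons t T)
  then show ?case by (cases t; cases "snd t") auto
qed simp

lemma set_labels: "set (labels T) = {l. \<exists>r. (r, Some l) \<in> set T}"
  by (auto simp: labels_def split: option.splits)

lemma card_labels_single: "card (set (labels [t])) \<le> 1"
  by (cases t; cases "snd t") auto

text \<open>Cutting the run \<open>u + v\<close> leaves \<open>u\<close> at the front, while the
  former first run lands next to \<open>v\<close> and merges with it. The runs between these two are
  reversed and those behind stay, so two labels at most are dropped and the others undergo one
  flip.\<close>

lemma flip_labelled_word:
  assumes T: "T \<noteq> []" and dist: "distinct (labels T)"
  obtains T' F where "flip i (run_word (map fst T)) = run_word (map fst T')" "T' \<noteq> []"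
    "finite F" "card F \<le> 2" "flips_within 1 (filter (\<lambda>l. l \<notin> F) (labels T)) (labels T')"
    "\<And>r l. (r, Some l) \<in> set T' \<Longrightarrow> (r, Some l) \<in> set T"
proof -
  obtain A u v B where R: "map fst T = A @ (u + v) # B"
    and t: "take i (run_word (map fst T)) = run_word (A @ [u])"
    and dr: "drop i (run_word (map fst T)) = run_word (v # B)"
    using run_word_split[of "map fst T" "take i (run_word (map fst T))" "drop i (run_word (map fst T))"] T
    by (metis append_take_drop_id map_is_Nil_conv)
  have fl: "flip i (run_word (map fst T)) = run_word (u # rev A) @ run_word (v # B)"
    unfolding flip_def t dr by (simp only: rev_run_word rev_append rev.simps append.simps)
  from R obtain TA q TB where TT: "T = TA @ q # TB" "A = map fst TA" "fst q = u + v" "B = map fst TB"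
    by (auto simp: map_eq_append_conv map_eq_Cons_conv append_eq_map_conv Cons_eq_map_conv)
  show thesis
  proof (cases TA)
    \<comment> \<open>The cut falls into the first run, so only ones are reversed and the word stays
      the same.\<close>
    case Nil
    show thesis
    proof (rule that[of T "{}"])
      show "flip i (run_word (map fst T)) = run_word (map fst T)"
        using fl TT Nil by (simp add: replicate_add)
    qed (use T flips_within_refl in auto)
  next
    case (Cons a TA')
    let ?T' = "(u, None) # rev TA' @ (fst a + v, None) # TB"
    let ?F = "set (labels [a]) \<union> set (labels [q])"
    show thesis
    proof (rule that[of ?T' ?F])
      show "flip i (run_word (map fst T)) = run_word (map fst ?T')"
        using run_word_join[of "u # rev (map fst TA')" "fst a" v B] fl TT Cons
        by (simp add: rev_map)
      show "card ?F \<le> 2"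
        using card_Un_le[of "set (labels [a])" "set (labels [q])"]
          card_labels_single[of a] card_labels_single[of q] by linarith
      have lab: "labels T = labels [a] @ labels TA' @ labels [q] @ labels TB"
        using TT Cons labels_simps(4)[of "[a]" "TA' @ [q] @ TB"]
          labels_simps(4)[of "[q]" TB] by simp
      have "filter (\<lambda>l. l \<notin> ?F) (labels T) = labels TA' @ labels TB"
      proof -
        have "filter (\<lambda>l. l \<notin> ?F) (labels TA') = labels TA'"
          "filter (\<lambda>l. l \<notin> ?F) (labels TB) = labels TB"
          "filter (\<lambda>l. l \<notin> ?F) (labels [a]) = []"
          "filter (\<lambda>l. l \<notin> ?F) (labels [q]) = []"
          using dist unfolding lab by (auto simp: filter_id_conv filter_empty_conv)
        then show ?thesis unfolding lab filter_append by simp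
      qed
      moreover have "labels ?T' = flip (length (labels TA')) (labels TA' @ labels TB)"
        by (simp add: flip_append labels_rev)
      ultimately show "flips_within 1 (filter (\<lambda>l. l \<notin> ?F) (labels T)) (labels ?T')"
        using flips_within_flip by metis
      show "(r, Some l) \<in> set T" if "(r, Some l) \<in> set ?T'" for r l
        using that TT Cons by auto
    qed auto
  qed
qed

lemma fold_flip_labelled_word:
  assumes "T \<noteq> []" and "distinct (labels T)"
  obtains T' F where "fold flip is (run_word (map fst T)) = run_word (map fst T')" "T' \<noteq> []"
    "finite F" "card F \<le> 2 * length is"
    "flips_within (length is) (filter (\<lambda>l. l \<notin> F) (labels T)) (labels T')"
    "\<And>r l. (r, Some l) \<in> set T' \<Longrightarrow> (r, Some l) \<in> set T"
proof -
  have "\<exists>T' F. fold flip is (run_word (map fst T)) = run_word (map fst T') \<and> T' \<noteq> [] \<and>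
    finite F \<and> card F \<le> 2 * length is \<and>
    flips_within (length is) (filter (\<lambda>l. l \<notin> F) (labels T)) (labels T') \<and>
    (\<forall>r l. (r, Some l) \<in> set T' \<longrightarrow> (r, Some l) \<in> set T)"
    using assms
  proof (induction "is" arbitrary: T)
    case Nil
    then show ?case
      by (intro exI[of _ T] exI[of _ "{}"]) (auto simp: flips_within_refl)
  next
    case (Cons i "is")
    from flip_labelled_word[OF Cons.prems, of i] obtain T1 F1 where 1:
      "flip i (run_word (map fst T)) = run_word (map fst T1)" "T1 \<noteq> []"
      "finite F1" "card F1 \<le> 2" "flips_within 1 (filter (\<lambda>l. l \<notin> F1) (labels T)) (labels T1)"
      "\<And>r l. (r, Some l) \<in> set T1 \<Longrightarrow> (r, Some l) \<in> set T" by blast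
    have "mset (labels T1) = mset (filter (\<lambda>l. l \<notin> F1) (labels T))"
      using mset_flips_within[OF 1(5)] .
    then have "distinct (labels T1)"
      using Cons.prems(2) by (metis distinct_filter mset_eq_imp_distinct_iff)
    from Cons.IH[OF 1(2) this] obtain T2 F2 where 2:
      "fold flip is (run_word (map fst T1)) = run_word (map fst T2)" "T2 \<noteq> []"
      "finite F2" "card F2 \<le> 2 * length is"
      "flips_within (length is) (filter (\<lambda>l. l \<notin> F2) (labels T1)) (labels T2)"
      "\<forall>r l. (r, Some l) \<in> set T2 \<longrightarrow> (r, Some l) \<in> set T1" by blast
    \<comment> \<open>Labels that later flips destroy are deleted beforehand; on the labels that
      survive to the end the first flip still acts as a flip.\<close>
    have "flips_within 1 (filter (\<lambda>l. l \<notin> F1 \<union> F2) (labels T)) (filter (\<lambda>l. l \<notin> F2) (labels T1))"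
      using flips_within_filter[OF 1(5), of "\<lambda>l. l \<notin> F2"] by (simp add: conj_commute)
    from flips_within_trans[OF this 2(5)]
    have "flips_within (length (i # is)) (filter (\<lambda>l. l \<notin> F1 \<union> F2) (labels T)) (labels T2)" by simp
    moreover have "card (F1 \<union> F2) \<le> 2 * length (i # is)"
      using card_Un_le[of F1 F2] 1(4) 2(4) by simp
    ultimately show ?case using 1 2
      by (intro exI[of _ T2] exI[of _ "F1 \<union> F2"]) auto
  qed
  with that show thesis by blast
qed

subsection \<open>Recovering the flips of the original strings\<close>

text \<open>Induction on the number of indices. A tight proper subset is matched inside its own
  union and the remaining indices outside it. Without one, every nonempty proper subset has an
  element to spare, so an arbitrary first choice can be removed.\<close>

lemma hall:
  assumes "finite I" "\<And>i. i \<in> I \<Longrightarrow> finite (A i)"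
    "\<And>S. S \<subseteq> I \<Longrightarrow> card S \<le> card (\<Union>(A ` S))"
  shows "\<exists>f. inj_on f I \<and> (\<forall>i\<in>I. f i \<in> A i)"
  using assms
proof (induction "card I" arbitrary: I A rule: less_induct)
  case less
  note fin = less.prems(1,2) and hall = less.prems(3)
  show ?case
  proof (cases "I = {}")
    case False
    show ?thesis
    proof (cases "\<exists>S. S \<subset> I \<and> S \<noteq> {} \<and> card (\<Union>(A ` S)) = card S")
      case True
      then obtain S where S: "S \<subset> I" "S \<noteq> {}" "card (\<Union>(A ` S)) = card S" by blast
      have finS: "finite S" using S fin finite_subset by blast
      obtain f where f: "inj_on f S" "\<forall>i\<in>S. f i \<in> A i"
        using less.hyps[of S A] S fin hall finS psubset_card_mono[OF fin(1) S(1)]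
        by (meson order.trans psubset_imp_subset subsetD)
      let ?U = "\<Union>(A ` S)"
      have "card Q \<le> card (\<Union>((\<lambda>i. A i - ?U) ` Q))" if Q: "Q \<subseteq> I - S" for Q
      proof -
        have fQ: "finite Q" using Q fin finite_subset by blast
        \<comment> \<open>Hall's condition for \<open>Q\<close> together with the tight set
          \<open>S\<close>; taking away the \<open>card S\<close> elements of \<open>?U\<close>
          leaves enough for \<open>Q\<close>.\<close>
        have "card (Q \<union> S) \<le> card (\<Union>(A ` (Q \<union> S)))" using Q S hall[of "Q \<union> S"] by blast
        also have "\<Union>(A ` (Q \<union> S)) = \<Union>((\<lambda>i. A i - ?U) ` Q) \<union> ?U" by auto
        also have "card \<dots> \<le> card (\<Union>((\<lambda>i. A i - ?U) ` Q)) + card ?U" by (rule card_Un_le)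
        finally show ?thesis using Q S(3) fQ finS card_Un_disjoint[of Q S] by fastforce
      qed
      moreover have "card (I - S) < card I"
        using S fin(1) by (intro psubset_card_mono) auto
      ultimately obtain g where g: "inj_on g (I - S)" "\<forall>i\<in>I - S. g i \<in> A i - ?U"
        using less.hyps[of "I - S" "\<lambda>i. A i - ?U"] fin by auto
      let ?h = "\<lambda>i. if i \<in> S then f i else g i"
      have fU: "f v \<in> ?U" if "v \<in> S" for v using f(2) that by auto
      have gU: "g u \<notin> ?U" if "u \<in> I - S" for u using g(2) that by (simp only: Diff_iff) auto
      have "inj_on ?h I"
      proof (rule inj_onI)
        fix x y assume xy: "x \<in> I" "y \<in> I" "?h x = ?h y"
        consider "x \<in> S" "y \<in> S" | "x \<in> S" "y \<notin> S" | "x \<notin> S" "y \<in> S" | "x \<notin> S" "y \<notin> S"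
          by blast
        then show "x = y"
        proof cases
          case 1
          then show ?thesis using xy inj_onD[OF f(1), of x y] by simp
        next
          case 2
          then show ?thesis using xy fU[of x] gU[of y] by simp
        next
          case 3
          then show ?thesis using xy fU[of y] gU[of x] by simp
        next
          case 4
          then show ?thesis using xy inj_onD[OF g(1), of x y] by simp
        qed
      qed
      moreover have "\<forall>i\<in>I. ?h i \<in> A i" using f g by auto
      ultimately show ?thesis by blast
    next
      case strict: False
      obtain i where i: "i \<in> I" using False by blast
      have "card {i} \<le> card (A i)" using hall[of "{i}"] i by simp
      then obtain b where b: "b \<in> A i" by fastforce
      have "card Q \<le> card (\<Union>((\<lambda>i. A i - {b}) ` Q))" if Q: "Q \<subseteq> I - {i}" for Q
      proof (cases "Q = {}")
        case False
        have "Q \<subset> I" using Q i by blast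
        then have "card Q < card (\<Union>(A ` Q))" using strict hall[of Q] False
          by (metis le_neq_implies_less psubset_imp_subset)
        moreover have "\<Union>((\<lambda>i. A i - {b}) ` Q) = \<Union>(A ` Q) - {b}" by auto
        ultimately show ?thesis by (simp add: card_Diff_singleton_if) linarith
      qed simp
      moreover have "card (I - {i}) < card I" using i fin(1) by (intro psubset_card_mono) auto
      ultimately obtain g where g: "inj_on g (I - {i})" "\<forall>j\<in>I - {i}. g j \<in> A j - {b}"
        using less.hyps[of "I - {i}" "\<lambda>j. A j - {b}"] fin by auto
      have "inj_on (g(i := b)) I"
      proof (rule inj_onI)
        fix x y assume "x \<in> I" "y \<in> I" "(g(i := b)) x = (g(i := b)) y"
        then show "x = y" using g
          by (cases "x = i"; cases "y = i") (auto dest: inj_onD)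
      qed
      moreover have "\<forall>j\<in>I. (g(i := b)) j \<in> A j" using g b by auto
      ultimately show ?thesis by blast
    qed
  qed simp
qed

text \<open>\<open>Q\<close> picks one position from each block, and division is monotone, so the
  increasing list of \<open>Q\<close> meets the blocks in their order.\<close>

lemma map_div_filter_upt:
  fixes m N n :: nat
  assumes "Q \<subseteq> {..<m}" "bij_betw (\<lambda>q. q div N) Q {..<n}"
  shows "map (\<lambda>q. q div N) (filter (\<lambda>q. q \<in> Q) [0..<m]) = [0..<n]"
proof (rule sorted_distinct_set_unique)
  have "set (filter (\<lambda>q. q \<in> Q) [0..<m]) = Q" using assms(1) by auto
  then show "distinct (map (\<lambda>q. q div N) (filter (\<lambda>q. q \<in> Q) [0..<m]))"
    "set (map (\<lambda>q. q div N) (filter (\<lambda>q. q \<in> Q) [0..<m])) = set [0..<n]"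
    using assms(2) by (auto simp: distinct_map bij_betw_def atLeast0LessThan)
  have "sorted (filter (\<lambda>q. q \<in> Q) [0..<m])" by (simp add: sorted_wrt_filter)
  then show "sorted (map (\<lambda>q. q div N) (filter (\<lambda>q. q \<in> Q) [0..<m]))"
    by (rule sorted_map_mono) (auto intro: mono_onI div_le_mono)
qed simp_all

section \<open>Blocks of equal runs\<close>

definition block_runs :: "nat \<Rightarrow> nat list \<Rightarrow> nat list" where
  "block_runs N X = concat (map (\<lambda>a. replicate N (Suc a)) X)"

lemma block_runs_simps [simp]:
  "block_runs N [] = []" "block_runs N (a # X) = replicate N (Suc a) @ block_runs N X"
  "block_runs N (X @ Y) = block_runs N X @ block_runs N Y"
  by (simp_all add: block_runs_def)

lemma length_block_runs [simp]: "length (block_runs N X) = length X * N"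
  by (induction X) simp_all

lemma rev_block_runs: "rev (block_runs N X) = block_runs N (rev X)"
  by (induction X) simp_all

lemma block_runs_conv:
  "block_runs N X = map (\<lambda>p. Suc (X ! (p div N))) [0..<length X * N]"
proof (cases "N = 0")
  case False
  then show ?thesis
  proof (induction X rule: rev_induct)
    case (snoc a X)
    have "[0..<length (X @ [a]) * N] = [0..<length X * N] @ [length X * N..<length X * N + N]"
      using upt_add_eq_append[of 0 "length X * N" N] by (simp add: add.commute)
    moreover have "map (\<lambda>p. Suc ((X @ [a]) ! (p div N))) [0..<length X * N]
      = map (\<lambda>p. Suc (X ! (p div N))) [0..<length X * N]"
      using snoc.prems by (auto simp: nth_append less_mult_imp_div_less)
    moreover have "map (\<lambda>p. Suc ((X @ [a]) ! (p div N))) [length X * N..<length X * N + N]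
      = replicate N (Suc a)"
    proof (rule replicate_eqI)
      fix y assume "y \<in> set (map (\<lambda>p. Suc ((X @ [a]) ! (p div N))) [length X * N..<length X * N + N])"
      then obtain p where p: "y = Suc ((X @ [a]) ! (p div N))"
        "length X * N \<le> p" "p < length X * N + N" by auto
      then have "p div N = length X"
        by (intro div_nat_eqI) (simp_all add: mult.commute)
      with p show "y = Suc a" by simp
    qed simp
    ultimately show ?case using snoc.IH[OF snoc.prems] by (simp only: map_append block_runs_simps) simp
  qed simp
qed (simp add: block_runs_def)

text \<open>The extra entry is the empty run of ones behind the final zero of the code.\<close>

lemma block_runs_snoc_conv:
  "block_runs N X @ [0] = map (\<lambda>p. if p < length X * N then Suc (X ! (p div N)) else 0) [0..<Suc (length X * N)]"
  by (simp add: block_runs_conv)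

text \<open>A block is constant and hence its own reversal, so flipping whole blocks mimics flipping
  symbols. \<open>E\<close> makes room for the trailing empty run.\<close>

lemma flips_within_block_runs:
  assumes "flips_within k X Y" shows "flips_within k (block_runs N X @ E) (block_runs N Y @ E)"
proof -
  have "block_runs N (fold flip is X) @ E
    = fold flip (map (\<lambda>i. length (take i X) * N) is) (block_runs N X @ E)" for "is"
  proof (induction "is" arbitrary: X)
    case (Cons i "is")
    have "flip (length (take i X) * N) (block_runs N X @ E) = block_runs N (flip i X) @ E"
      using flip_append[of "block_runs N (take i X)" "block_runs N (drop i X) @ E"]
        block_runs_simps(3)[of N "take i X" "drop i X"]
      by (simp add: rev_block_runs flip_def[of i])
    moreover have "(\<lambda>j. length (take j X) * N) = (\<lambda>j. length (take j (flip i X)) * N)" by auto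
    ultimately show ?case using Cons[of "flip i X"] by simp
  qed simp
  with assms show ?thesis unfolding flips_within_def by (metis length_map)
qed

lemma labels_position_unique:
  assumes "distinct (labels U)" "x < length U" "y < length U"
    "snd (U ! x) = Some p" "snd (U ! y) = Some p"
  shows "x = y"
  using assms
proof (induction U arbitrary: x y)
  case (Cons u U)
  have mem: "p \<in> set (labels U)" if "z < length U" "snd (U ! z) = Some p" for z
  proof -
    have "U ! z = (fst (U ! z), Some p)" "U ! z \<in> set U" using that by (simp_all add: prod_eq_iff)
    then show ?thesis unfolding set_labels by (metis (mono_tags) mem_Collect_eq)
  qed
  obtain r l where u: "u = (r, l)" by (cases u)
  have dist: "distinct (labels U)" "l = Some p \<Longrightarrow> p \<notin> set (labels U)"
    using Cons.prems(1) unfolding u by (cases l; auto)+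
  show ?case
  proof (cases x; cases y)
    fix x' assume "x = Suc x'" "y = 0"
    with Cons.prems u dist(2) mem[of x'] show ?thesis by simp
  next
    fix y' assume "x = 0" "y = Suc y'"
    with Cons.prems u dist(2) mem[of y'] show ?thesis by simp
  next
    fix x' y' assume "x = Suc x'" "y = Suc y'"
    with Cons.prems Cons.IH[OF dist(1), of x' y'] show ?thesis by simp
  qed simp
qed simp

lemma flips_within_of_block_words:
  assumes len: "length X = n" "length Y = n" and k: "2 * k < N"
    and fl: "flips_within k (run_word (block_runs N X @ [0])) (run_word (block_runs N Y @ [0]))"
  shows "flips_within k X Y"
proof -
  have N: "N > 0" using k by simp
  from fl obtain "is" where lis: "length is \<le> k"
    and fis: "fold flip is (run_word (block_runs N X @ [0])) = run_word (block_runs N Y @ [0])"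
    unfolding flips_within_def by blast
  define m where "m = n * N"
  \<comment> \<open>Each run of a block is labelled by its initial position; the trailing empty run
    gets no label.\<close>
  define T where "T = map (\<lambda>p. (Suc (X ! (p div N)), Some p)) [0..<m] @ [(0, None)]"
  have fstT: "map fst T = block_runs N X @ [0]"
    by (simp add: T_def block_runs_conv len m_def comp_def)
  have labT: "labels T = [0..<m]"
  proof -
    have "labels (map (\<lambda>p. (f p, Some p)) ps) = ps" for f :: "nat \<Rightarrow> nat" and ps :: "nat list"
      by (induction ps) simp_all
    then show ?thesis by (simp add: T_def)
  qed
  have "T \<noteq> []" "distinct (labels T)" using labT by (simp_all add: T_def)
  from fold_flip_labelled_word[OF this, of "is"] obtain T' F where
    w: "fold flip is (run_word (map fst T)) = run_word (map fst T')" "T' \<noteq> []" and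
    F: "finite F" "card F \<le> 2 * length is" and
    fw: "flips_within (length is) (filter (\<lambda>l. l \<notin> F) (labels T)) (labels T')" and
    sub: "\<And>r l. (r, Some l) \<in> set T' \<Longrightarrow> (r, Some l) \<in> set T" by blast
  have fstT': "map fst T' = block_runs N Y @ [0]"
  proof (rule run_word_inject)
    show "run_word (map fst T') = run_word (block_runs N Y @ [0])" using w(1) fis fstT by metis
  qed (use w(2) in simp_all)
  then have lenT': "length T' = Suc m"
    using len by (metis length_map length_append_singleton length_block_runs m_def)
  have msetT': "mset (labels T') = mset (filter (\<lambda>l. l \<notin> F) [0..<m])"
    using mset_flips_within[OF fw] labT by simp
  have setT': "set (labels T') = {..<m} - F"
    using mset_eq_setD[OF msetT'] by auto
  \<comment> \<open>The intact run that started at position \<open>p\<close> stands at position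
    \<open>q\<close> of the final word.\<close>
  define at where "at q p \<longleftrightarrow> q < Suc m \<and> snd (T' ! q) = Some p" for q p
  have atD: "q < m \<and> p < m \<and> X ! (p div N) = Y ! (q div N)" if "at q p" for q p
  proof -
    have q: "q < Suc m" "snd (T' ! q) = Some p" using that by (simp_all add: at_def)
    have "fst (T' ! q) = (block_runs N Y @ [0]) ! q"
      using fstT' lenT' q(1) by (metis nth_map)
    also have "\<dots> = (if q < m then Suc (Y ! (q div N)) else 0)"
      using q(1) unfolding block_runs_snoc_conv len m_def[symmetric] by (simp del: upt_Suc)
    finally have v: "fst (T' ! q) = (if q < m then Suc (Y ! (q div N)) else 0)" .
    have "T' ! q = (fst (T' ! q), Some p)" using q(2) by (metis prod.collapse)
    then have "(fst (T' ! q), Some p) \<in> set T" using sub q(1) lenT' by (metis nth_mem)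
    \<comment> \<open>Runs of blocks have positive length, so an intact one cannot end in the last
      place, where the run is empty.\<close>
    with v show ?thesis by (auto simp: T_def split: if_splits)
  qed
  have at_ex: "\<exists>q. at q p" if p: "p \<in> set (labels T')" for p
  proof -
    from p obtain r where "(r, Some p) \<in> set T'" unfolding set_labels by blast
    then obtain q where "q < length T'" "T' ! q = (r, Some p)" by (metis in_set_conv_nth)
    then show ?thesis using lenT' by (intro exI[of _ q]) (simp add: at_def)
  qed
  have at_inj: "at q p \<Longrightarrow> at q p' \<Longrightarrow> p = p'" for q p p' by (simp add: at_def)
  define A where "A i = {q div N | q p. at q p \<and> p div N = i}" for i
  have A_sub: "A i \<subseteq> {..<n}" for i
    unfolding A_def by (auto dest!: atD simp: m_def less_mult_imp_div_less)
  have hallc: "card S \<le> card (\<Union>(A ` S))" if S: "S \<subseteq> {..<n}" for S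
  proof -
    let ?J = "\<Union>(A ` S)"
    have fin: "finite S" "finite ?J"
      using S A_sub by (auto intro: finite_subset[of _ "{..<n}"])
    have blk: "finite ((\<lambda>q. q div N) -` J)" "card ((\<lambda>q. q div N) -` J) = card J * N"
      if "finite J" for J :: "nat set"
    proof -
      have "bij_betw (\<lambda>(j, r). j * N + r) (J \<times> {..<N}) ((\<lambda>q. q div N) -` J)"
        by (rule bij_betw_byWitness[where f' = "\<lambda>q. (q div N, q mod N)"]) (use N in auto)
      then show "finite ((\<lambda>q. q div N) -` J)" "card ((\<lambda>q. q div N) -` J) = card J * N"
        using that by (auto dest: bij_betw_finite bij_betw_same_card simp: card_cartesian_product)
    qed
    let ?P = "(\<lambda>q. q div N) -` S"
    have "?P \<subseteq> {..<m}"
    proof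
      fix p assume "p \<in> ?P"
      then have "p div N < n" using S by auto
      then show "p \<in> {..<m}" using N by (simp add: m_def div_less_iff_less_mult)
    qed
    then have lab: "?P - F \<subseteq> set (labels T')" unfolding setT' by blast
    define g where "g p = (SOME q. at q p)" for p
    have g: "at (g p) p" if "p \<in> ?P - F" for p
    proof -
      have "\<exists>q. at q p" using lab that by (intro at_ex) (rule subsetD)
      then show ?thesis unfolding g_def by (rule someI_ex)
    qed
    \<comment> \<open>Different surviving runs end at different positions, all of them inside the
      blocks of \<open>?J\<close>.\<close>
    have "card (?P - F) \<le> card ((\<lambda>q. q div N) -` ?J)"
    proof (rule card_inj_on_le[where f = g])
      show "inj_on g (?P - F)"
      proof (rule inj_onI)
        fix p p' assume "p \<in> ?P - F" "p' \<in> ?P - F" "g p = g p'"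
        with g[of p] g[of p'] show "p = p'" using at_inj[of "g p" p p'] by simp
      qed
      show "g ` (?P - F) \<subseteq> (\<lambda>q. q div N) -` ?J"
      proof
        fix q assume "q \<in> g ` (?P - F)"
        then obtain p where p: "p \<in> ?P - F" "q = g p" by auto
        have "g p div N \<in> A (p div N)" unfolding A_def using g[OF p(1)] by auto
        with p show "q \<in> (\<lambda>q. q div N) -` ?J" by auto
      qed
      show "finite ((\<lambda>q. q div N) -` ?J)" using fin(2) by (rule blk(1))
    qed
    moreover have "card ?P - card F \<le> card (?P - F)" using F(1) by (rule diff_card_le_card_Diff)
    ultimately have "card S * N - 2 * k \<le> card ?J * N"
      unfolding blk(2)[OF fin(1)] blk(2)[OF fin(2)] using F(2) lis by linarith
    \<comment> \<open>Being short of even one block would mean a loss of at least \<open>N\<close>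
      runs, but at most \<open>2 * k\<close> are lost.\<close>
    then have "card S * N < (card ?J + 1) * N" using k by simp
    then have "card S < card ?J + 1" by (rule mult_less_cancel2[THEN iffD1, THEN conjunct2])
    then show ?thesis by simp
  qed
  have "\<exists>s. inj_on s {..<n} \<and> (\<forall>i\<in>{..<n}. s i \<in> A i)"
    using hallc by (intro hall finite_subset[OF A_sub]) simp_all
  then obtain s where s: "inj_on s {..<n}" "\<forall>i\<in>{..<n}. s i \<in> A i" by (elim exE conjE)
  have s_ex: "\<exists>q p. at q p \<and> p div N = i \<and> q div N = s i" if "i < n" for i
  proof -
    have "s i \<in> A i" using s(2) that by simp
    then obtain q p where "s i = q div N" "at q p" "p div N = i" unfolding A_def by auto
    then show ?thesis by (intro exI[of _ q] exI[of _ p]) simp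
  qed
  \<comment> \<open>For each block of \<open>X\<close> one travelling run is fixed, with initial
    position \<open>hp i\<close> and final position \<open>hq i\<close>.\<close>
  define hp where "hp i = (SOME p. \<exists>q. at q p \<and> p div N = i \<and> q div N = s i)" for i
  define hq where "hq i = (SOME q. at q (hp i) \<and> hp i div N = i \<and> q div N = s i)" for i
  have h: "at (hq i) (hp i)" "hp i div N = i" "hq i div N = s i" if "i < n" for i
  proof -
    from s_ex[OF that] have "\<exists>p q. at q p \<and> p div N = i \<and> q div N = s i" by (elim exE) (intro exI)
    then have "\<exists>q. at q (hp i) \<and> hp i div N = i \<and> q div N = s i"
      unfolding hp_def by (rule someI_ex)
    then have "at (hq i) (hp i) \<and> hp i div N = i \<and> hq i div N = s i"
      unfolding hq_def by (rule someI_ex)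
    then show "at (hq i) (hp i)" "hp i div N = i" "hq i div N = s i" by simp_all
  qed
  define P where "P = hp ` {..<n}"
  define Q where "Q = hq ` {..<n}"
  have s_bij: "s ` {..<n} = {..<n}"
  proof (rule card_subset_eq)
    show "s ` {..<n} \<subseteq> {..<n}"
    proof
      fix j assume "j \<in> s ` {..<n}"
      then obtain i where "i < n" "j = s i" by auto
      then show "j \<in> {..<n}" using s(2) subsetD[OF A_sub[of i], of j] by simp
    qed
  qed (use card_image[OF s(1)] in simp_all)
  have P: "P \<subseteq> {..<m}" "bij_betw (\<lambda>p. p div N) P {..<n}"
  proof -
    show "P \<subseteq> {..<m}" unfolding P_def using atD[OF h(1)] by auto
    have "(\<lambda>p. p div N) ` P = {..<n}" unfolding P_def image_image using h(2) by simp
    moreover have "inj_on (\<lambda>p. p div N) P" unfolding P_def using h(2) by (auto intro!: inj_onI)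
    ultimately show "bij_betw (\<lambda>p. p div N) P {..<n}" by (simp add: bij_betw_def)
  qed
  have Q: "Q \<subseteq> {..<m}" "bij_betw (\<lambda>q. q div N) Q {..<n}"
  proof -
    show "Q \<subseteq> {..<m}" unfolding Q_def using atD[OF h(1)] by auto
    have "(\<lambda>q. q div N) ` Q = {..<n}"
      unfolding Q_def image_image using h(3) s_bij by simp
    moreover have "inj_on (\<lambda>q. q div N) Q"
    proof (rule inj_onI)
      fix q q' assume "q \<in> Q" "q' \<in> Q" and eq: "q div N = q' div N"
      then obtain i i' where i: "i < n" "q = hq i" "i' < n" "q' = hq i'" by (auto simp: Q_def)
      then have "s i = s i'" using eq h(3) by simp
      then show "q = q'" using i inj_onD[OF s(1), of i i'] by simp
    qed
    ultimately show "bij_betw (\<lambda>q. q div N) Q {..<n}" by (simp add: bij_betw_def)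
  qed
  have PF: "P \<subseteq> set (labels T')"
  proof
    fix p assume "p \<in> P"
    then obtain i where "i < n" "p = hp i" by (auto simp: P_def)
    then have q: "at (hq i) p" using h(1) by simp
    then have "T' ! hq i = (fst (T' ! hq i), Some p)" "T' ! hq i \<in> set T'"
      using lenT' by (simp_all add: at_def prod_eq_iff)
    then show "p \<in> set (labels T')" unfolding set_labels by (metis (mono_tags) mem_Collect_eq)
  qed
  \<comment> \<open>A position carries at most one label and a label occurs only once, so the
    representatives may be selected by origin or by destination.\<close>
  have atPQ: "q \<in> Q \<longleftrightarrow> p \<in> P" if "at q p" for q p
  proof
    assume "q \<in> Q"
    then obtain i where i: "i < n" "q = hq i" by (auto simp: Q_def)
    then have "p = hp i" using at_inj[OF that] h(1)[OF i(1)] by simp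
    with i(1) show "p \<in> P" by (auto simp: P_def)
  next
    assume "p \<in> P"
    then obtain i where i: "i < n" "p = hp i" by (auto simp: P_def)
    have "distinct (labels T')"
      using mset_eq_imp_distinct_iff[OF msetT'] by simp
    then have "hq i = q"
      using that h(1)[OF i(1)] lenT' unfolding at_def i(2)[symmetric]
      by (intro labels_position_unique) auto
    with i(1) show "q \<in> Q" by (auto simp: Q_def)
  qed
  \<comment> \<open>Only the representatives are kept: they spell \<open>X\<close> at the start and
    \<open>Y\<close> at the end.\<close>
  have "filter (\<lambda>l. l \<in> P) (filter (\<lambda>l. l \<notin> F) (labels T)) = filter (\<lambda>l. l \<in> P) [0..<m]"
    using PF unfolding labT setT' filter_filter by (intro filter_cong) auto
  then have "flips_within (length is) (filter (\<lambda>l. l \<in> P) [0..<m]) (filter (\<lambda>l. l \<in> P) (labels T'))"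
    using flips_within_filter[OF fw, of "\<lambda>l. l \<in> P"] by simp
  from flips_within_map[OF this, of "\<lambda>p. X ! (p div N)"]
  have fX: "flips_within (length is) (map (\<lambda>p. X ! (p div N)) (filter (\<lambda>l. l \<in> P) [0..<m]))
    (map (\<lambda>p. X ! (p div N)) (filter (\<lambda>l. l \<in> P) (labels T')))" .
  have eX: "map (\<lambda>p. X ! (p div N)) (filter (\<lambda>l. l \<in> P) [0..<m]) = X"
    using map_div_filter_upt[OF P] map_nth[of X] len
    by (metis (mono_tags, lifting) map_map comp_apply map_eq_conv)
  have "map (\<lambda>p. X ! (p div N)) (filter (\<lambda>l. l \<in> P) (labels T'))
    = map (\<lambda>q. Y ! (q div N)) (filter (\<lambda>q. q \<in> Q) [0..<Suc m])"
  proof -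
    have T'_conv: "T' = map (\<lambda>q. T' ! q) [0..<Suc m]" using map_nth[of T'] lenT' by simp
    have "map (\<lambda>p. X ! (p div N)) (filter (\<lambda>l. l \<in> P) (labels (map (\<lambda>q. T' ! q) qs)))
      = map (\<lambda>q. Y ! (q div N)) (filter (\<lambda>q. q \<in> Q) qs)" if "set qs \<subseteq> {..<Suc m}" for qs
      using that
    proof (induction qs)
      case (Cons q qs)
      have IH: "map (\<lambda>p. X ! (p div N)) (filter (\<lambda>l. l \<in> P) (labels (map (\<lambda>q. T' ! q) qs)))
        = map (\<lambda>q. Y ! (q div N)) (filter (\<lambda>q. q \<in> Q) qs)" using Cons by simp
      show ?case
      proof (cases "snd (T' ! q)")
        case None
        have "q \<notin> Q"
        proof
          assume "q \<in> Q"
          then obtain i where "i < n" "q = hq i" by (auto simp: Q_def)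
          with None h(1)[of i] show False by (simp add: at_def)
        qed
        moreover obtain r where "T' ! q = (r, None)" using None by (metis prod.collapse)
        ultimately show ?thesis using IH by simp
      next
        case (Some p)
        with Cons.prems have "at q p" by (simp add: at_def)
        moreover obtain r where "T' ! q = (r, Some p)" using Some by (metis prod.collapse)
        ultimately show ?thesis using IH atPQ[of q p] atD[of q p] by simp
      qed
    qed simp
    moreover have "set [0..<Suc m] \<subseteq> {..<Suc m}" by auto
    ultimately show ?thesis using T'_conv by metis
  qed
  also have "\<dots> = Y"
  proof -
    have "Q \<subseteq> {..<Suc m}" using Q(1) by auto
    from map_div_filter_upt[OF this Q(2)] show ?thesis using map_nth[of Y] len
      by (metis (mono_tags, lifting) map_map comp_apply map_eq_conv)
  qed
  finally have "flips_within (length is) X Y" using fX eX by simp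
  then show ?thesis using lis by (rule flips_within_mono)
qed

lemma D_block_words:
  assumes "length X = n" "length Y = n" "mset X = mset Y" "4 * n < N"
  shows "D X Y = D (run_word (block_runs N X @ [0])) (run_word (block_runs N Y @ [0]))" (is "_ = D ?x ?y")
proof (rule antisym)
  have XY: "flips_within (2 * n) X Y" using compatible_flips_within[OF assms(3)] assms(2) by simp
  have "flips_within (D X Y) ?x ?y"
    by (intro flips_within_word flips_within_block_runs flips_within_D[OF XY]) simp
  then show le: "D ?x ?y \<le> D X Y" by (rule D_le)
  have "D X Y \<le> 2 * n" using XY by (rule D_le)
  \<comment> \<open>The loss of runs is governed by the binary distance, which is known to be small
    only through the inequality just shown.\<close>
  then have "2 * D ?x ?y < N" using le assms(4) by simp
  moreover have "flips_within (D ?x ?y) ?x ?y" using \<open>flips_within (D X Y) ?x ?y\<close> by (rule flips_within_D)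
  ultimately show "D X Y \<le> D ?x ?y"
    using flips_within_of_block_words[OF assms(1,2)] D_le by blast
qed

subsection \<open>Turing machine computations\<close>

text \<open>Only an upper bound on the number of steps is recorded, so that bounds can be rounded up
  along the way.\<close>

definition reaches :: "tm \<Rightarrow> nat \<Rightarrow> config \<Rightarrow> config \<Rightarrow> bool" where
  "reaches M t c c' \<longleftrightarrow> (\<exists>k\<le>t. tm_run M k c = c')"

lemma reaches_refl: "reaches M 0 c c"
  by (simp add: reaches_def tm_run_def)

lemma reaches_step: "tm_step M c = c' \<Longrightarrow> reaches M 1 c c'"
  unfolding reaches_def tm_run_def by (intro exI[of _ 1]) simp

lemma reaches_trans:
  assumes "reaches M s a b" "reaches M t b c" shows "reaches M (s + t) a c"
proof -
  from assms obtain i j where "i \<le> s" "tm_run M i a = b" "j \<le> t" "tm_run M j b = c"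
    unfolding reaches_def by blast
  then show ?thesis unfolding reaches_def tm_run_def
    by (intro exI[of _ "j + i"]) (simp add: funpow_add)
qed

lemma reaches_mono: "reaches M s a b \<Longrightarrow> s \<le> t \<Longrightarrow> reaches M t a b"
  unfolding reaches_def using le_trans by blast

definition tape_at :: "int \<Rightarrow> nat list \<Rightarrow> int \<Rightarrow> nat" where
  "tape_at z w = (\<lambda>i. tape_of w (i - z))"

text \<open>The tape holds the reverse of l followed by r, starting at cell z. The head is on the
  first cell of r in cfgR and on the last cell before r in cfgL.\<close>

definition cfgR :: "int \<Rightarrow> nat \<Rightarrow> nat list \<Rightarrow> nat list \<Rightarrow> config" where
  "cfgR z q l r = (q, tape_at z (rev l @ r), z + int (length l))"

definition cfgL :: "int \<Rightarrow> nat \<Rightarrow> nat list \<Rightarrow> nat list \<Rightarrow> config" where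
  "cfgL z q l r = (q, tape_at z (rev l @ r), z + int (length l) - 1)"

lemma cfgL_Cons: "cfgL z q (s # l) r = cfgR z q l (s # r)"
  by (simp add: cfgL_def cfgR_def)

lemma tape_of_blank: "tape_of (w @ [0]) = tape_of w"
  by (auto simp: tape_of_def nth_append fun_eq_iff)

text \<open>The tape is blank beyond the two lists; an explicit blank lets the step rules act at the
  right end.\<close>

lemma cfgR_blank: "cfgR z q l [] = cfgR z q l [0]"
  using tape_of_blank[of "rev l"] by (simp add: cfgR_def tape_at_def)

lemma cfgL_blank: "cfgL z q l (r @ [0]) = cfgL z q l r"
  using tape_of_blank[of "rev l @ r"] by (simp add: cfgL_def tape_at_def)

lemma cfgL_blanks: "cfgL z q l (replicate n 0) = cfgL z q l []"
proof (induction n)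
  case (Suc n)
  then show ?case using cfgL_blank[of z q l "replicate n 0"]
    by (simp add: replicate_append_same)
qed simp

lemma tape_at_read: "tape_at z (rev l @ s # r) (z + int (length l)) = s"
  by (simp add: tape_at_def tape_of_def nth_append)

lemma tape_at_write:
  "(tape_at z (rev l @ s # r))(z + int (length l) := s') = tape_at z (rev l @ s' # r)"
proof
  fix i
  have "(rev l @ s # r) ! n = (rev l @ s' # r) ! n" if "n \<noteq> length l" for n
    using that by (simp add: nth_append nth_Cons')
  then show "((tape_at z (rev l @ s # r))(z + int (length l) := s')) i = tape_at z (rev l @ s' # r) i"
    by (auto simp: tape_at_read) (auto simp: tape_at_def tape_of_def)
qed

lemma step_right:
  "delta M q s = (q', s', 1) \<Longrightarrow> q \<noteq> 1 \<Longrightarrow> tm_step M (cfgR z q l (s # r)) = cfgR z q' (s' # l) r"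
  by (simp add: cfgR_def tm_step_def tape_at_read tape_at_write)

lemma step_stay:
  "delta M q s = (q', s', 0) \<Longrightarrow> q \<noteq> 1 \<Longrightarrow> tm_step M (cfgR z q l (s # r)) = cfgR z q' l (s' # r)"
  by (simp add: cfgR_def tm_step_def tape_at_read tape_at_write)

lemma step_left:
  "delta M q s = (q', s', - 1) \<Longrightarrow> q \<noteq> 1 \<Longrightarrow> tm_step M (cfgR z q l (s # r)) = cfgL z q' l (s' # r)"
  by (simp add: cfgR_def cfgL_def tm_step_def tape_at_read tape_at_write)

section \<open>Passes of the head over the tape\<close>

lemma scan_right:
  assumes "\<forall>s\<in>set w. delta M q s = (q, g s, 1)" "q \<noteq> 1"
  shows "reaches M (length w) (cfgR z q l (w @ r)) (cfgR z q (rev (map g w) @ l) r)"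
  using assms(1)
proof (induction w arbitrary: l)
  case (Cons s w)
  have "reaches M 1 (cfgR z q l (s # w @ r)) (cfgR z q (g s # l) (w @ r))"
    using Cons.prems assms(2) by (intro reaches_step step_right) auto
  with Cons.IH[of "g s # l"] Cons.prems show ?case
    using reaches_trans[of M 1 _ _ "length w"] by simp
qed (simp add: reaches_refl)

lemma scan_left:
  assumes "\<forall>s\<in>set w. delta M q s = (q, g s, - 1)" "q \<noteq> 1"
  shows "reaches M (length w) (cfgL z q (w @ l) r) (cfgL z q l (rev (map g w) @ r))"
  using assms(1)
proof (induction w arbitrary: r)
  case (Cons s w)
  have "reaches M 1 (cfgL z q (s # w @ l) r) (cfgL z q (w @ l) (g s # r))"
    unfolding cfgL_Cons using Cons.prems assms(2) by (intro reaches_step step_left) auto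
  with Cons.IH[of "g s # r"] Cons.prems show ?case
    using reaches_trans[of M 1 _ _ "length w"] by simp
qed (simp add: reaches_refl)

text \<open>The round trip for one output symbol: \<open>s\<close> is the input cell to be marked,
  \<open>w\<close> all that lies between it and the right end, \<open>y\<close> the symbol appended
  there.\<close>

lemma excursion:
  assumes "\<forall>x\<in>set w. delta M q x = (q, x, - 1)" "delta M q s = (q', s', 1)"
    "\<forall>x\<in>set w. delta M q' x = (q', x, 1)" "delta M q' 0 = (q'', y, 0)" "q \<noteq> 1" "q' \<noteq> 1"
  shows "reaches M (2 * length w + 2) (cfgL z q (w @ s # l) []) (cfgL z q'' (y # w @ s' # l) [])"
proof -
  have "reaches M (length w) (cfgL z q (w @ s # l) []) (cfgL z q (s # l) (rev w))"
    using scan_left[of w M q id] assms(1,5) by (metis append_Nil2 id_apply list.map_id)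
  moreover have "reaches M 1 (cfgL z q (s # l) (rev w)) (cfgR z q' (s' # l) (rev w))"
    unfolding cfgL_Cons using assms by (intro reaches_step step_right)
  moreover have "reaches M (length w) (cfgR z q' (s' # l) (rev w)) (cfgR z q' (w @ s' # l) [])"
    using scan_right[of "rev w" M q' id z "s' # l" "[]"] assms(3,6) by simp
  moreover have "reaches M 1 (cfgR z q' (w @ s' # l) []) (cfgL z q'' (y # w @ s' # l) [])"
    unfolding cfgL_Cons cfgR_blank[of z q'] using assms by (intro reaches_step step_stay)
  ultimately have "reaches M (length w + (1 + (length w + 1))) (cfgL z q (w @ s # l) [])
     (cfgL z q'' (y # w @ s' # l) [])" by (meson reaches_trans)
  then show ?thesis by (rule reaches_mono) simp
qed

lemma sweep_right:
  assumes "\<forall>x\<in>set w. delta M q x = (q, g x, 1)" "delta M q 0 = (q', 0, - 1)" "q \<noteq> 1"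
  shows "reaches M (length w + 1) (cfgR z q l (rev w)) (cfgL z q' (map g w @ l) [])"
proof (rule reaches_trans)
  show "reaches M (length w) (cfgR z q l (rev w)) (cfgR z q (map g w @ l) [])"
    using scan_right[of "rev w" M q g z l "[]"] assms(1,3) by (simp add: rev_map)
  have "cfgL z q' (map g w @ l) [] = cfgL z q' (map g w @ l) [0]"
    using cfgL_blank[of z q' "map g w @ l" "[]"] by simp
  then show "reaches M 1 (cfgR z q (map g w @ l) []) (cfgL z q' (map g w @ l) [])"
    unfolding cfgR_blank[of z q] using assms by (simp only:) (intro reaches_step step_left)
qed

subsection \<open>The blow-up machine\<close>

text \<open>
  Symbols 0 to 4 are those of the input and output, 5 marks input that has been moved away.
  Moved input symbols b (2, 3 or 4) are stored as cells with a status (0: to do, 1: copied in the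
  current round, 2: done) and a tally mark c, which counts the rounds.
\<close>

definition cell :: "nat \<Rightarrow> nat \<Rightarrow> nat \<Rightarrow> nat" where
  "cell b st c = 6 + 6 * (b - 2) + 2 * st + c"

definition cell_base :: "nat \<Rightarrow> nat" where "cell_base s = (s - 6) div 6 + 2"
definition cell_status :: "nat \<Rightarrow> nat" where "cell_status s = (s - 6) div 2 mod 3"
definition cell_tally :: "nat \<Rightarrow> nat" where "cell_tally s = (s - 6) mod 2"

lemma cell_props [simp]:
  assumes "st < 3" "c < 2"
  shows "2 \<le> b \<Longrightarrow> cell_base (cell b st c) = b" "cell_status (cell b st c) = st"
    "cell_tally (cell b st c) = c"
proof -
  have st: "st = 0 \<or> st = 1 \<or> st = 2" and c: "c = 0 \<or> c = 1" using assms by auto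
  show "2 \<le> b \<Longrightarrow> cell_base (cell b st c) = b"
    using st c by (auto simp: cell_def cell_base_def)
  have "(6 * b' + (2 * st + c)) div 2 mod 3 = st" for b' :: nat
    using st c by (elim disjE; simp; presburger)
  from this[of "b - 2"] show "cell_status (cell b st c) = st"
    by (simp add: cell_def cell_status_def add.assoc)
  show "cell_tally (cell b st c) = c"
    using c by (auto simp: cell_def cell_tally_def mod_simps) presburger+
qed

lemma cell_ge [simp]: "6 \<le> cell b st c" "0 < cell b st c" "cell b st c \<noteq> 5" "\<not> cell b st c < 6" "\<not> cell b st c < 5"
  "\<not> cell b st c \<le> 4" "cell b st c \<noteq> 0"
  by (simp_all add: cell_def)

text \<open>
  State 0 fetches the next input symbol, and 2, 3, 4 carry it to the left end. State 5 looks for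
  the next cell to copy, 6, 7, 8 append its output symbol 2, 1 or 4. At the end of a copy, 9 looks
  for an untallied cell. If there is one, 10 walks to the left end and 11 makes the copied cells
  available again; otherwise 12 marks them as done and clears the tally. State 13 erases the cells.
\<close>

definition blowup_delta :: "nat \<Rightarrow> nat \<Rightarrow> nat \<times> nat \<times> int" where
  "blowup_delta q s =
    (if q = 0 then
       if s = 0 then (5, 0, -1) else if 2 \<le> s \<and> s \<le> 4 then (s, 5, -1) else (0, s, 1)
     else if q = 2 \<or> q = 3 \<or> q = 4 then
       if s = 0 then (0, cell q 0 0, 0) else (q, s, -1)
     else if q = 5 then
       if s = 0 then (13, 0, 1)
       else if s = 5 then (5, 0, -1)
       else if s < 5 \<or> cell_status s \<noteq> 0 then (5, s, -1)
       else if cell_base s = 2 then (6, cell 2 1 (cell_tally s), 1)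
       else if cell_base s = 3 then (7, cell 3 1 (cell_tally s), 1)
       else (8, cell 4 2 (cell_tally s), 1)
     else if q = 6 then if s = 0 then (5, 2, 0) else (6, s, 1)
     else if q = 7 then if s = 0 then (9, 1, 0) else (7, s, 1)
     else if q = 8 then if s = 0 then (5, 4, 0) else (8, s, 1)
     else if q = 9 then
       if s = 0 then (12, 0, 1)
       else if s < 6 \<or> cell_tally s = 1 then (9, s, -1)
       else (10, cell (cell_base s) (cell_status s) 1, -1)
     else if q = 10 then if s = 0 then (11, 0, 1) else (10, s, -1)
     else if q = 11 then
       if s = 0 then (5, 0, -1)
       else if 6 \<le> s \<and> cell_status s = 1 then (11, cell (cell_base s) 0 (cell_tally s), 1)
       else (11, s, 1)
     else if q = 12 then
       if s = 0 then (5, 0, -1)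
       else if 6 \<le> s
         then (12, cell (cell_base s) (if cell_status s = 1 then 2 else cell_status s) 0, 1)
       else (12, s, 1)
     else if 6 \<le> s then (13, 0, 1) else (1, s, 0))"

text \<open>The 3 * 3 * 2 kinds of cells take up the symbols 6 to 23, hence the alphabet size
  24.\<close>

definition blowup_tm :: tm where
  "blowup_tm = \<lparr>nstates = 14, nsyms = 24, delta = blowup_delta\<rparr>"

lemma wf_blowup_tm: "wf_tm blowup_tm"
proof -
  have cb: "cell b st c < 24" if "b \<le> 4" "st < 3" "c < 2" for b st c
    using that by (simp add: cell_def)
  have "cell_base s \<le> 4" if "s < 24" for s
  proof -
    have "(s - 6) div 6 < 3" using that by (intro less_mult_imp_div_less) simp
    then show ?thesis by (simp add: cell_base_def)
  qed
  moreover have "cell_status s < 3" "cell_tally s < 2" for s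
    by (simp_all add: cell_status_def cell_tally_def)
  moreover have if_mem: "(if P then u else v) \<in> S" if "P \<Longrightarrow> u \<in> S" "\<not> P \<Longrightarrow> v \<in> S"
    for P and u v :: "nat \<times> nat \<times> int" and S
    using that by simp
  ultimately have "blowup_delta q s \<in> {..<14} \<times> {..<24} \<times> {-1, 0, 1}" if "s < 24" for q s
    unfolding blowup_delta_def using that
    by (intro if_mem; (elim disjE)?; simp add: cb)
  then have "case blowup_delta q s of (q', s', m) \<Rightarrow> q' < 14 \<and> s' < 24 \<and> m \<in> {-1, 0, 1}"
    if "s < 24" for q s
    using that unfolding mem_Times_iff case_prod_beta lessThan_iff by blast
  then show ?thesis by (simp add: wf_tm_def blowup_tm_def)
qed

section \<open>The transition table by kind of symbol\<close>

lemma delta_blank: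
  "blowup_delta 0 0 = (5, 0, -1)" "blowup_delta 5 0 = (13, 0, 1)"
  "blowup_delta 6 0 = (5, 2, 0)" "blowup_delta 7 0 = (9, 1, 0)" "blowup_delta 8 0 = (5, 4, 0)"
  "blowup_delta 9 0 = (12, 0, 1)" "blowup_delta 10 0 = (11, 0, 1)"
  "blowup_delta 11 0 = (5, 0, -1)" "blowup_delta 12 0 = (5, 0, -1)"
  "q \<in> {2, 3, 4} \<Longrightarrow> blowup_delta q 0 = (0, cell q 0 0, 0)"
  by (auto simp: blowup_delta_def)

lemma delta_output:
  assumes "x \<in> {1, 2, 4}"
  shows "blowup_delta 5 x = (5, x, -1)" "blowup_delta 6 x = (6, x, 1)"
    "blowup_delta 7 x = (7, x, 1)" "blowup_delta 8 x = (8, x, 1)" "blowup_delta 9 x = (9, x, -1)"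
    "blowup_delta 10 x = (10, x, -1)" "blowup_delta 11 x = (11, x, 1)"
    "blowup_delta 12 x = (12, x, 1)" "blowup_delta 13 x = (1, x, 0)"
  using assms by (auto simp: blowup_delta_def)

lemma delta_cell:
  assumes "2 \<le> b" "st < 3" "c < 2"
  shows "blowup_delta 0 (cell b st c) = (0, cell b st c, 1)"
    "q \<in> {2, 3, 4} \<Longrightarrow> blowup_delta q (cell b st c) = (q, cell b st c, -1)"
    "st \<noteq> 0 \<Longrightarrow> blowup_delta 5 (cell b st c) = (5, cell b st c, -1)"
    "q \<in> {6, 7, 8} \<Longrightarrow> blowup_delta q (cell b st c) = (q, cell b st c, 1)"
    "blowup_delta 10 (cell b st c) = (10, cell b st c, -1)"
    "blowup_delta 11 (cell b st c) = (11, cell b (if st = 1 then 0 else st) c, 1)"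
    "blowup_delta 12 (cell b st c) = (12, cell b (if st = 1 then 2 else st) 0, 1)"
    "blowup_delta 13 (cell b st c) = (13, 0, 1)"
  using assms by (auto simp: blowup_delta_def)

lemma delta_todo:
  assumes "c < 2"
  shows "blowup_delta 5 (cell 2 0 c) = (6, cell 2 (Suc 0) c, 1)"
    "blowup_delta 5 (cell 3 0 c) = (7, cell 3 (Suc 0) c, 1)"
    "blowup_delta 5 (cell 4 0 c) = (8, cell 4 2 c, 1)"
  using assms by (auto simp: blowup_delta_def)

lemma delta_tally:
  assumes "2 \<le> b" "st < 3"
  shows "blowup_delta 9 (cell b st (Suc 0)) = (9, cell b st (Suc 0), -1)"
    "blowup_delta 9 (cell b st 0) = (10, cell b st (Suc 0), -1)"
  using assms by (auto simp: blowup_delta_def)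

lemma delta_filler:
  "blowup_delta 0 5 = (0, 5, 1)" "blowup_delta 5 5 = (5, 0, -1)"
  "q \<in> {2, 3, 4} \<Longrightarrow> blowup_delta q 5 = (q, 5, -1)"
  "s \<in> {2, 3, 4} \<Longrightarrow> blowup_delta 0 s = (s, 5, -1)"
  by (auto simp: blowup_delta_def)

lemma delta_blowup [simp]: "delta blowup_tm = blowup_delta"
  by (simp add: blowup_tm_def)

text \<open>In the main phase the whole tape is determined by the input B, the numbers dn of done and k
  of copied cells, the tally j, and the output.\<close>

definition status :: "nat \<Rightarrow> nat \<Rightarrow> nat \<Rightarrow> nat" where
  "status dn k i = (if i < dn then 2 else if i < dn + k then 1 else 0)"

definition tally :: "nat \<Rightarrow> nat \<Rightarrow> nat" where
  "tally j i = (if i < j then 1 else 0)"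

lemma status_less [simp]: "status dn k i < 3" and tally_less [simp]: "tally j i < 2"
  by (simp_all add: status_def tally_def)

definition cells :: "nat list \<Rightarrow> nat \<Rightarrow> nat \<Rightarrow> nat \<Rightarrow> nat list" where
  "cells B dn k j = map (\<lambda>i. cell (B ! i) (status dn k i) (tally j i)) [0..<length B]"

text \<open>From left to right: a blank that stops walks to the left, the input cells in reverse
  order, and the output from the origin on, with the head at the right end. The reversal puts the
  first input symbol next to the output, where a walk to the left meets it first.\<close>

definition conf :: "nat \<Rightarrow> nat list \<Rightarrow> nat \<Rightarrow> nat \<Rightarrow> nat \<Rightarrow> nat list \<Rightarrow> config" where
  "conf q B dn k j O' = cfgL (- int (length B) - 1) q (rev O' @ cells B dn k j @ [0]) []"

lemma length_cells [simp]: "length (cells B dn k j) = length B"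
  by (simp add: cells_def)

lemma map_upt_split:
  assumes "i < n" shows "map f [0..<n] = map f [0..<i] @ f i # map f [Suc i..<n]"
  using upt_add_eq_append[of 0 i "n - i"] upt_conv_Cons[OF assms] assms by simp

text \<open>Isolates the one cell that a pass rewrites; the tapes before and after agree around
  it.\<close>

lemma cells_update:
  assumes "i < length B" "\<And>i'. i' < length B \<Longrightarrow> i' \<noteq> i \<Longrightarrow>
    cell (B ! i') (status dn k i') (tally j i') = cell (B ! i') (status dn' k' i') (tally j' i')"
  obtains pre post where
    "cells B dn k j = pre @ cell (B ! i) (status dn k i) (tally j i) # post"
    "cells B dn' k' j' = pre @ cell (B ! i) (status dn' k' i) (tally j' i) # post"
    "pre = map (\<lambda>i. cell (B ! i) (status dn k i) (tally j i)) [0..<i]" "length pre < length B"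
proof (rule that[OF _ _ refl])
  show "cells B dn k j = map (\<lambda>i. cell (B ! i) (status dn k i) (tally j i)) [0..<i] @
      cell (B ! i) (status dn k i) (tally j i) #
      map (\<lambda>i. cell (B ! i) (status dn k i) (tally j i)) [Suc i..<length B]"
    unfolding cells_def using assms(1) by (rule map_upt_split)
  have "cells B dn' k' j' = map (\<lambda>i. cell (B ! i) (status dn' k' i) (tally j' i)) [0..<i] @
      cell (B ! i) (status dn' k' i) (tally j' i) #
      map (\<lambda>i. cell (B ! i) (status dn' k' i) (tally j' i)) [Suc i..<length B]"
    unfolding cells_def using assms(1) by (rule map_upt_split)
  also have "map (\<lambda>i. cell (B ! i) (status dn' k' i) (tally j' i)) [0..<i]
      = map (\<lambda>i. cell (B ! i) (status dn k i) (tally j i)) [0..<i]"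
    using assms by (intro map_cong) auto
  also have "map (\<lambda>i. cell (B ! i) (status dn' k' i) (tally j' i)) [Suc i..<length B]
      = map (\<lambda>i. cell (B ! i) (status dn k i) (tally j i)) [Suc i..<length B]"
    using assms by (intro map_cong) auto
  finally show "cells B dn' k' j' = map (\<lambda>i. cell (B ! i) (status dn k i) (tally j i)) [0..<i] @
      cell (B ! i) (status dn' k' i) (tally j' i) #
      map (\<lambda>i. cell (B ! i) (status dn k i) (tally j i)) [Suc i..<length B]" .
qed (use assms in simp)

definition blowup_string :: "nat \<Rightarrow> nat list \<Rightarrow> nat list" where
  "blowup_string N X = concat (map (\<lambda>a. concat (replicate N (replicate (a + 1) 2 @ [1]))) X)"

lemma length_blowup_string: "length (blowup_string N X) = N * length (enc_sym_string X)"
  by (induction X) (simp_all add: blowup_string_def enc_sym_string_def length_concat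
    sum_list_replicate algebra_simps)

lemma set_blowup_string: "set (blowup_string N X) \<subseteq> {1, 2}"
  by (auto simp: blowup_string_def)

context
  fixes B :: "nat list"
  assumes B: "set B \<subseteq> {2, 3, 4}"
begin

lemma B_nth: "i < length B \<Longrightarrow> B ! i = 2 \<or> B ! i = 3 \<or> B ! i = 4"
  using B nth_mem by blast

lemma B_nth_ge [simp]: "i < length B \<Longrightarrow> 2 \<le> B ! i"
  using B_nth by fastforce

text \<open>Common to all three output symbols. The cells before \<open>dn + k\<close> are done or
  copied and are skipped by state 5, so the excursion turns at the first cell still to do.\<close>

lemma conf_emit:
  assumes i: "dn + k < length B" and O': "set O' \<subseteq> {1, 2, 4}"
    and d1: "blowup_delta 5 (cell (B ! (dn + k)) 0 (tally j (dn + k)))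
      = (q', cell (B ! (dn + k)) (status dn' k' (dn + k)) (tally j (dn + k)), 1)"
    and d2: "q' \<in> {6, 7, 8}" "blowup_delta q' 0 = (q'', y, 0)"
    and st: "\<And>i. i \<noteq> dn + k \<Longrightarrow> status dn k i = status dn' k' i"
  shows "reaches blowup_tm (2 * (length O' + length B) + 2) (conf 5 B dn k j O')
    (conf q'' B dn' k' j (O' @ [y]))"
proof -
  obtain pre post where
    c1: "cells B dn k j = pre @ cell (B ! (dn + k)) (status dn k (dn + k)) (tally j (dn + k)) # post" and
    c2: "cells B dn' k' j = pre @ cell (B ! (dn + k)) (status dn' k' (dn + k)) (tally j (dn + k)) # post" and
    pre: "pre = map (\<lambda>i. cell (B ! i) (status dn k i) (tally j i)) [0..<dn + k]" "length pre < length B"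
  proof (rule cells_update[OF i, of dn k j dn' k' j])
    show "cell (B ! i') (status dn k i') (tally j i') = cell (B ! i') (status dn' k' i') (tally j i')"
      if "i' \<noteq> dn + k" for i' using st[OF that] by simp
  qed (rule that)
  have s0: "status dn k (dn + k) = 0" by (simp add: status_def)
  have "reaches blowup_tm (2 * length (rev O' @ pre) + 2)
    (cfgL z 5 ((rev O' @ pre) @ cell (B ! (dn + k)) 0 (tally j (dn + k)) # post @ [0]) [])
    (cfgL z q'' (y # (rev O' @ pre) @ cell (B ! (dn + k)) (status dn' k' (dn + k)) (tally j (dn + k)) # post @ [0]) [])"
    for z
  proof (rule excursion)
    show "\<forall>x\<in>set (rev O' @ pre). delta blowup_tm 5 x = (5, x, - 1)"
    proof
      fix x assume "x \<in> set (rev O' @ pre)"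
      then consider "x \<in> {1, 2, 4}" | i' where "i' < dn + k" "x = cell (B ! i') (status dn k i') (tally j i')"
        using O' pre by auto
      then show "delta blowup_tm 5 x = (5, x, - 1)"
      proof cases
        case 1
        then show ?thesis by (simp only: delta_blowup delta_output)
      next
        case 2
        then have "status dn k i' \<noteq> 0" by (simp add: status_def)
        with 2 i show ?thesis by (simp add: delta_cell(3))
      qed
    qed
    show "\<forall>x\<in>set (rev O' @ pre). delta blowup_tm q' x = (q', x, 1)"
    proof
      fix x assume "x \<in> set (rev O' @ pre)"
      then consider "x \<in> {1, 2, 4}" | i' where "i' < dn + k" "x = cell (B ! i') (status dn k i') (tally j i')"
        using O' pre by auto
      then show "delta blowup_tm q' x = (q', x, 1)"
      proof cases
        case 1
        then show ?thesis using d2(1) delta_output[of x] by auto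
      next
        case 2
        then show ?thesis using i d2(1) by (simp add: delta_cell)
      qed
    qed
  qed (use d1 d2 in auto)
  from reaches_mono[OF this, of "2 * (length O' + length B) + 2"] pre(2)
  show ?thesis unfolding conf_def c1 c2 s0 by simp
qed

lemma conf_copy:
  assumes "dn + k < length B" "B ! (dn + k) = 2" "set O' \<subseteq> {1, 2, 4}"
  shows "reaches blowup_tm (2 * (length O' + length B) + 2) (conf 5 B dn k j O')
    (conf 5 B dn (Suc k) j (O' @ [2]))"
  by (rule conf_emit[where q' = 6]) (use assms in \<open>auto simp: delta_blank delta_todo status_def\<close>)

lemma conf_close:
  assumes "dn + k < length B" "B ! (dn + k) = 3" "set O' \<subseteq> {1, 2, 4}"
  shows "reaches blowup_tm (2 * (length O' + length B) + 2) (conf 5 B dn k j O')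
    (conf 9 B dn (Suc k) j (O' @ [1]))"
  by (rule conf_emit[where q' = 7]) (use assms in \<open>auto simp: delta_blank delta_todo status_def\<close>)

text \<open>The separator is copied only once, so it counts as done immediately.\<close>

lemma conf_separator:
  assumes "dn < length B" "B ! dn = 4" "set O' \<subseteq> {1, 2, 4}"
  shows "reaches blowup_tm (2 * (length O' + length B) + 2) (conf 5 B dn 0 j O')
    (conf 5 B (Suc dn) 0 j (O' @ [4]))"
  by (rule conf_emit[where q' = 8]) (use assms in \<open>auto simp: delta_blank delta_todo status_def\<close>)

text \<open>Cell \<open>j\<close> is the first without a mark. Once it is marked, the sweep back
  from the left end reopens the copied cells for another round.\<close>

lemma conf_tally:
  assumes j: "j < length B" and O': "set O' \<subseteq> {1, 2, 4}"
  shows "reaches blowup_tm (2 * (length O' + length B) + 2) (conf 9 B dn k j O')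
    (conf 5 B dn 0 (Suc j) O')"
proof -
  obtain pre post where
    c1: "cells B dn k j = pre @ cell (B ! j) (status dn k j) (tally j j) # post" and
    c2: "cells B dn k (Suc j) = pre @ cell (B ! j) (status dn k j) (tally (Suc j) j) # post" and
    pre: "pre = map (\<lambda>i. cell (B ! i) (status dn k i) (tally j i)) [0..<j]"
    by (rule cells_update[OF j, of dn k j dn k "Suc j"]) (auto simp: tally_def less_Suc_eq)
  have t: "tally j j = 0" "tally (Suc j) j = 1" by (simp_all add: tally_def)
  define z where "z = - int (length B) - 1"
  define w where "w = rev O' @ cells B dn k (Suc j)"
  have w: "w = (rev O' @ pre) @ cell (B ! j) (status dn k j) 1 # post"
    by (simp add: w_def c2 t)
  \<comment> \<open>State 10 stops at blanks only, and no cell is blank.\<close>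
  have post: "x \<noteq> 0" if "x \<in> set post" for x
  proof -
    have "x \<in> set (cells B dn k j)" using that c1 by simp
    then show ?thesis by (auto simp: cells_def)
  qed
  define u where "u = rev O' @ pre"
  have "reaches blowup_tm (length u)
    (cfgL z 9 (u @ cell (B ! j) (status dn k j) 0 # post @ [0]) [])
    (cfgL z 9 (cell (B ! j) (status dn k j) 0 # post @ [0]) (rev u))"
  proof -
    have "\<forall>x\<in>set u. delta blowup_tm 9 x = (9, x, - 1)"
      using O' j by (auto simp: u_def pre delta_blank delta_output delta_cell delta_tally delta_filler tally_def)
    from scan_left[of _ _ _ "\<lambda>x. x", OF this, of z _ "[]"] show ?thesis by simp
  qed
  moreover have "reaches blowup_tm 1
    (cfgL z 9 (cell (B ! j) (status dn k j) 0 # post @ [0]) (rev u))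
    (cfgL z 10 (post @ [0]) (cell (B ! j) (status dn k j) 1 # rev u))"
    unfolding cfgL_Cons using j
    by (intro reaches_step step_left) (simp_all add: delta_blank delta_output delta_cell delta_tally delta_filler)
  moreover have "reaches blowup_tm (length post)
    (cfgL z 10 (post @ [0]) (cell (B ! j) (status dn k j) 1 # rev u))
    (cfgL z 10 [0] (rev w))"
  proof -
    have "\<forall>x\<in>set post. delta blowup_tm 10 x = (10, x, - 1)"
      using post by (simp add: blowup_delta_def)
    from scan_left[of _ _ _ "\<lambda>x. x", OF this, of z "[0]"] show ?thesis by (simp add: w u_def)
  qed
  moreover have "reaches blowup_tm 1 (cfgL z 10 [0] (rev w)) (cfgR z 11 [0] (rev w))"
    unfolding cfgL_Cons by (intro reaches_step step_right) (simp_all add: delta_blank delta_output delta_cell delta_tally delta_filler)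
  moreover have "reaches blowup_tm (length w + 1) (cfgR z 11 [0] (rev w))
    (cfgL z 5 (rev O' @ cells B dn 0 (Suc j) @ [0]) [])"
  proof -
    define g where "g s = fst (snd (blowup_delta 11 s))" for s
    have g: "delta blowup_tm 11 x = (11, g x, 1)" if "x \<in> set w" for x
      using that O' by (auto simp: w_def cells_def g_def delta_blank delta_output delta_cell delta_tally delta_filler)
    have "map g (rev O') = rev O'"
      using O' by (intro map_idI) (auto simp: g_def delta_blank delta_output delta_cell delta_tally delta_filler)
    moreover have "map g (cells B dn k (Suc j)) = cells B dn 0 (Suc j)"
      by (auto simp: cells_def g_def delta_blank delta_output delta_cell delta_tally delta_filler, auto simp: status_def)
    ultimately have "map g w @ [0] = rev O' @ cells B dn 0 (Suc j) @ [0]"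
      by (simp add: w_def)
    with sweep_right[of w blowup_tm 11 g 5 z "[0]"] g show ?thesis
      by (simp add: delta_blank delta_output delta_cell delta_tally delta_filler)
  qed
  ultimately have "reaches blowup_tm (length u + (1 + (length post + (1 + (length w + 1)))))
    (cfgL z 9 (u @ cell (B ! j) (status dn k j) 0 # post @ [0]) [])
    (cfgL z 5 (rev O' @ cells B dn 0 (Suc j) @ [0]) [])"
    by (meson reaches_trans)
  moreover have "length u + 1 + length post = length w" by (simp add: w u_def)
  moreover have "length w = length O' + length B" by (simp add: w_def)
  ultimately show ?thesis
    unfolding conf_def c1 z_def t u_def by (auto elim: reaches_mono)
qed

text \<open>All cells are marked, so state 9 runs into the left blank, which signals the end of the
  current block.\<close>

lemma conf_next_block:
  assumes O': "set O' \<subseteq> {1, 2, 4}"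
  shows "reaches blowup_tm (2 * (length O' + length B) + 2) (conf 9 B dn k (length B) O')
    (conf 5 B (dn + k) 0 0 O')"
proof -
  define z where "z = - int (length B) - 1"
  define w where "w = rev O' @ cells B dn k (length B)"
  have "reaches blowup_tm (length w) (cfgL z 9 (w @ [0]) []) (cfgL z 9 [0] (rev w))"
  proof -
    have "\<forall>x\<in>set w. delta blowup_tm 9 x = (9, x, - 1)"
      using O' by (auto simp: w_def cells_def delta_output delta_tally tally_def)
    from scan_left[of _ _ _ "\<lambda>x. x", OF this, of z "[0]" "[]"] show ?thesis by simp
  qed
  moreover have "reaches blowup_tm 1 (cfgL z 9 [0] (rev w)) (cfgR z 12 [0] (rev w))"
    unfolding cfgL_Cons by (intro reaches_step step_right) (simp_all add: delta_blank delta_output delta_cell delta_tally delta_filler)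
  moreover have "reaches blowup_tm (length w + 1) (cfgR z 12 [0] (rev w))
    (cfgL z 5 (rev O' @ cells B (dn + k) 0 0 @ [0]) [])"
  proof -
    define g where "g s = fst (snd (blowup_delta 12 s))" for s
    have g: "delta blowup_tm 12 x = (12, g x, 1)" if "x \<in> set w" for x
      using that O' by (auto simp: w_def cells_def g_def delta_blank delta_output delta_cell delta_tally delta_filler)
    have "map g (rev O') = rev O'"
      using O' by (intro map_idI) (auto simp: g_def delta_blank delta_output delta_cell delta_tally delta_filler)
    moreover have "map g (cells B dn k (length B)) = cells B (dn + k) 0 0"
      by (auto simp: cells_def g_def delta_blank delta_output delta_cell delta_tally delta_filler, auto simp: status_def tally_def)
    ultimately have "map g w @ [0] = rev O' @ cells B (dn + k) 0 0 @ [0]"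
      by (simp add: w_def)
    with sweep_right[of w blowup_tm 12 g 5 z "[0]"] g show ?thesis
      by (simp add: delta_blank delta_output delta_cell delta_tally delta_filler)
  qed
  ultimately have "reaches blowup_tm (length w + (1 + (length w + 1)))
    (cfgL z 9 (w @ [0]) []) (cfgL z 5 (rev O' @ cells B (dn + k) 0 0 @ [0]) [])"
    by (meson reaches_trans)
  then show ?thesis unfolding conf_def z_def w_def
    by (auto elim!: reaches_mono)
qed

text \<open>With every cell done, state 5 runs to the left end. The erasing state 13 is stopped by
  the first output symbol, at the origin.\<close>

lemma conf_finish:
  assumes O': "set O' \<subseteq> {1, 2, 4}" "O' \<noteq> []"
  shows "reaches blowup_tm (2 * (length O' + length B) + 2) (conf 5 B (length B) 0 j O')
    (1, tape_of O', 0)"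
proof -
  define z where "z = - int (length B) - 1"
  let ?C = "cells B (length B) 0 j"
  have "reaches blowup_tm (length (rev O' @ ?C)) (cfgL z 5 ((rev O' @ ?C) @ [0]) [])
    (cfgL z 5 [0] (rev ?C @ O'))"
  proof -
    have "\<forall>x\<in>set (rev O' @ ?C). delta blowup_tm 5 x = (5, x, - 1)"
      using O' by (auto simp: cells_def delta_blank delta_output delta_cell delta_tally delta_filler, auto simp: status_def delta_cell)
    from scan_left[of _ _ _ "\<lambda>x. x", OF this, of z "[0]" "[]"] show ?thesis by simp
  qed
  moreover have "reaches blowup_tm 1 (cfgL z 5 [0] (rev ?C @ O')) (cfgR z 13 [0] (rev ?C @ O'))"
    unfolding cfgL_Cons by (intro reaches_step step_right) (simp_all add: delta_blank delta_output delta_cell delta_tally delta_filler)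
  moreover have "reaches blowup_tm (length (rev ?C)) (cfgR z 13 [0] (rev ?C @ O'))
    (cfgR z 13 (replicate (Suc (length B)) 0) O')"
  proof -
    have "\<forall>x\<in>set (rev ?C). delta blowup_tm 13 x = (13, 0, 1)"
      by (auto simp: cells_def delta_blank delta_output delta_cell delta_tally delta_filler)
    from scan_right[of _ _ _ "\<lambda>_. 0", OF this, of z "[0]" O'] show ?thesis
      by (simp add: map_replicate_const replicate_append_same)
  qed
  moreover have "reaches blowup_tm 1 (cfgR z 13 (replicate (Suc (length B)) 0) O')
    (cfgR z 1 (replicate (Suc (length B)) 0) O')"
  proof -
    obtain s r where O'_eq: "O' = s # r" and "s \<in> {1, 2, 4}" using O' by (cases O') auto
    then have "tm_step blowup_tm (cfgR z 13 l (s # r)) = cfgR z 1 l (s # r)" for l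
      using delta_output(9)[of s] by (intro step_stay) simp_all
    then show ?thesis unfolding O'_eq by (rule reaches_step)
  qed
  ultimately have "reaches blowup_tm (length (rev O' @ ?C) + (1 + (length (rev ?C) + 1)))
    (cfgL z 5 ((rev O' @ ?C) @ [0]) []) (cfgR z 1 (replicate (Suc (length B)) 0) O')"
    by (meson reaches_trans)
  moreover have "cfgR z 1 (replicate (Suc (length B)) 0) O' = (1, tape_of O', 0)"
  proof -
    have "tape_of (replicate m 0 @ w) i = tape_of w (i - int m)" for m w i
      by (auto simp: tape_of_def nth_append nat_diff_distrib nat_less_iff)
    then show ?thesis
      by (simp add: cfgR_def tape_at_def z_def fun_eq_iff del: replicate.simps)
  qed
  ultimately show ?thesis unfolding conf_def z_def by (auto elim!: reaches_mono)
qed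

text \<open>Invariant of the first phase: \<open>i\<close> symbols are stacked to the left of the
  origin and fillers occupy their old places. The next round crosses these \<open>2 * i\<close>
  cells twice and makes two more steps.\<close>

lemma transfer_input:
  assumes "i \<le> length B"
  shows "reaches blowup_tm (i * (4 * length B + 2)) (init_config B)
    (cfgR (- int (length B) - 1) 0 (replicate (Suc (length B) - i) 0)
      (rev (map (\<lambda>b. cell b 0 0) (take i B)) @ replicate i 5 @ drop i B))"
  using assms
proof (induction i)
  case 0
  have "tape_of (replicate m 0 @ w) i = tape_of w (i - int m)" for m w i
    by (auto simp: tape_of_def nth_append nat_diff_distrib nat_less_iff)
  then have "init_config B = cfgR (- int (length B) - 1) 0 (replicate (Suc (length B)) 0) B"
    by (simp add: init_config_def cfgR_def tape_at_def fun_eq_iff del: replicate.simps)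
  then show ?case by (simp add: reaches_refl del: replicate_Suc)
next
  case (Suc i)
  define z where "z = - int (length B) - 1"
  define C where "C = map (\<lambda>b. cell b 0 0) (take i B)"
  define s where "s = B ! i"
  define l where "l = replicate (length B - i) (0::nat)"
  have i: "i < length B" using Suc by simp
  have ge2: "2 \<le> b" if "b \<in> set (take i B)" for b
    using B in_set_takeD[OF that] by auto
  have s: "s \<in> {2, 3, 4}" using B_nth[OF i] by (simp add: s_def)
  have dr: "drop i B = s # drop (Suc i) B" using i by (simp add: s_def Cons_nth_drop_Suc)
  have rl: "replicate (Suc (length B) - i) 0 = 0 # l" "replicate (Suc (length B) - Suc i) 0 = l"
    using i by (simp_all add: l_def Suc_diff_le)
  have len: "length C = i" using i by (simp add: C_def)
  define w where "w = replicate i 5 @ C"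
  have "reaches blowup_tm (i * (4 * length B + 2)) (init_config B)
    (cfgR z 0 (0 # l) (rev w @ drop i B))"
    using Suc.IH i unfolding rl(1) by (simp add: z_def w_def C_def)
  moreover have "reaches blowup_tm (length (rev w)) (cfgR z 0 (0 # l) (rev w @ drop i B))
    (cfgR z 0 (w @ 0 # l) (drop i B))"
  proof -
    have "\<forall>x\<in>set (rev w). delta blowup_tm 0 x = (0, x, 1)"
      by (auto simp: w_def C_def ge2 delta_blank delta_output delta_cell delta_tally delta_filler)
    from scan_right[of _ _ _ "\<lambda>x. x", OF this] show ?thesis by simp
  qed
  moreover have "reaches blowup_tm 1 (cfgR z 0 (w @ 0 # l) (drop i B))
    (cfgL z s (w @ 0 # l) (5 # drop (Suc i) B))"
    unfolding dr using s by (intro reaches_step step_left) (auto simp: delta_blank delta_output delta_cell delta_tally delta_filler)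
  moreover have "reaches blowup_tm (length w) (cfgL z s (w @ 0 # l) (5 # drop (Suc i) B))
    (cfgL z s (0 # l) (rev w @ 5 # drop (Suc i) B))"
  proof -
    have "\<forall>x\<in>set w. delta blowup_tm s x = (s, x, -1)"
      using s by (auto simp: w_def C_def ge2 delta_blank delta_output delta_cell delta_tally delta_filler)
    from scan_left[of _ _ _ "\<lambda>x. x", OF this] s show ?thesis by auto
  qed
  moreover have "reaches blowup_tm 1 (cfgL z s (0 # l) (rev w @ 5 # drop (Suc i) B))
    (cfgR z 0 l (cell s 0 0 # rev w @ 5 # drop (Suc i) B))"
    unfolding cfgL_Cons using s by (intro reaches_step step_stay) (auto simp: delta_blank delta_output delta_cell delta_tally delta_filler)
  ultimately have R: "reaches blowup_tm (i * (4 * length B + 2) + (length (rev w) + (1 + (length w + 1))))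
    (init_config B) (cfgR z 0 l (cell s 0 0 # rev w @ 5 # drop (Suc i) B))"
    by (meson reaches_trans)
  have eq: "cell s 0 0 # rev w @ 5 # drop (Suc i) B
    = rev (map (\<lambda>b. cell b 0 0) (take (Suc i) B)) @ replicate (Suc i) 5 @ drop (Suc i) B"
    using i by (simp add: w_def C_def s_def take_Suc_conv_app_nth replicate_append_same replicate_app_Cons_same)
  show ?case unfolding rl z_def[symmetric] eq[symmetric]
    by (rule reaches_mono[OF R]) (use i in \<open>simp add: w_def len\<close>)
qed

text \<open>After the last transfer state 0 runs off the right end, and the first walk of state 5
  erases the fillers.\<close>

lemma start_conf:
  "reaches blowup_tm (4 * (length B + 1)^2) (init_config B) (conf 5 B 0 0 0 [])"
proof -
  define z where "z = - int (length B) - 1"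
  let ?C = "cells B 0 0 0"
  have C: "map (\<lambda>b. cell b 0 0) B = ?C"
    by (intro nth_equalityI) (simp_all add: cells_def status_def tally_def)
  define w where "w = replicate (length B) 5 @ ?C"
  have "reaches blowup_tm (length B * (4 * length B + 2)) (init_config B)
    (cfgR z 0 [0] (rev w))"
    using transfer_input[of "length B"] by (simp add: C z_def w_def)
  moreover have "reaches blowup_tm (length w + 1) (cfgR z 0 [0] (rev w)) (cfgL z 5 (w @ [0]) [])"
  proof -
    have "\<forall>x\<in>set w. delta blowup_tm 0 x = (0, x, 1)"
      by (auto simp: w_def cells_def delta_blank delta_output delta_cell delta_tally delta_filler)
    from sweep_right[of _ _ _ "\<lambda>x. x", OF this, of 5 z "[0]"] show ?thesis
      by (simp add: delta_blank delta_output delta_cell delta_tally delta_filler)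
  qed
  moreover have "reaches blowup_tm (length B) (cfgL z 5 (w @ [0]) []) (conf 5 B 0 0 0 [])"
  proof -
    have "\<forall>x\<in>set (replicate (length B) 5). delta blowup_tm 5 x = (5, 0, -1)"
      by (auto simp: delta_blank delta_output delta_cell delta_tally delta_filler)
    from scan_left[of _ _ _ "\<lambda>_. 0", OF this, of z "?C @ [0]" "[]"] show ?thesis
      by (simp add: w_def conf_def z_def map_replicate_const cfgL_blanks)
  qed
  ultimately have "reaches blowup_tm (length B * (4 * length B + 2) + (length w + 1 + length B))
    (init_config B) (conf 5 B 0 0 0 [])" by (meson reaches_trans)
  then show ?thesis
    by (rule reaches_mono) (simp add: w_def power2_eq_square algebra_simps)
qed

text \<open>\<open>Z\<close> bounds the output length throughout, so all passes share one time bound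
  and only their number matters: one for each 2 and one for the closing 3.\<close>

lemma copy_block:
  assumes "\<forall>i<m. B ! (dn + k + i) = 2" "B ! (dn + k + m) = 3" "dn + k + m < length B"
    "set O' \<subseteq> {1, 2, 4}" "length O' + m + 1 \<le> Z"
  shows "reaches blowup_tm (Suc m * (2 * (Z + length B) + 2)) (conf 5 B dn k j O')
    (conf 9 B dn (k + m + 1) j (O' @ replicate m 2 @ [1]))"
  using assms
proof (induction m arbitrary: k O')
  case 0
  then show ?case using conf_close[of dn k O' j] by (auto elim!: reaches_mono)
next
  case (Suc m)
  have "reaches blowup_tm (2 * (Z + length B) + 2) (conf 5 B dn k j O')
    (conf 5 B dn (Suc k) j (O' @ [2]))"
    by (rule reaches_mono[OF conf_copy]) (use Suc.prems in \<open>auto dest: spec[of _ 0]\<close>)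
  moreover have "reaches blowup_tm (Suc m * (2 * (Z + length B) + 2)) (conf 5 B dn (Suc k) j (O' @ [2]))
    (conf 9 B dn (Suc k + m + 1) j ((O' @ [2]) @ replicate m 2 @ [1]))"
  proof (rule Suc.IH)
    show "\<forall>i<m. B ! (dn + Suc k + i) = 2"
    proof (intro allI impI)
      fix i assume "i < m"
      then show "B ! (dn + Suc k + i) = 2" using Suc.prems(1)[rule_format, of "Suc i"] by simp
    qed
  qed (use Suc.prems in auto)
  ultimately have "reaches blowup_tm (2 * (Z + length B) + 2 + Suc m * (2 * (Z + length B) + 2))
    (conf 5 B dn k j O') (conf 9 B dn (Suc k + m + 1) j ((O' @ [2]) @ replicate m 2 @ [1]))"
    by (rule reaches_trans)
  then show ?case by (auto elim!: reaches_mono simp: replicate_app_Cons_same)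
qed

text \<open>\<open>e\<close> is the number of unmarked cells. The round that finds none unmarked has
  made a copy too, hence \<open>Suc e\<close> copies; each takes \<open>m + 1\<close> passes and one
  more for the tally.\<close>

lemma repeat_block:
  assumes "\<forall>i<m. B ! (dn + i) = 2" "B ! (dn + m) = 3" "dn + m < length B"
    "set O' \<subseteq> {1, 2, 4}" "length O' + Suc e * (m + 1) \<le> Z" "e \<le> length B"
  shows "reaches blowup_tm (Suc e * ((m + 2) * (2 * (Z + length B) + 2)))
    (conf 5 B dn 0 (length B - e) O')
    (conf 5 B (dn + m + 1) 0 0 (O' @ concat (replicate (Suc e) (replicate m 2 @ [1]))))"
  using assms(4-)
proof (induction e arbitrary: O')
  case 0
  have "reaches blowup_tm (Suc m * (2 * (Z + length B) + 2)) (conf 5 B dn 0 (length B) O')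
    (conf 9 B dn (0 + m + 1) (length B) (O' @ replicate m 2 @ [1]))"
    using assms 0 by (intro copy_block) auto
  moreover have "reaches blowup_tm (2 * (Z + length B) + 2)
    (conf 9 B dn (0 + m + 1) (length B) (O' @ replicate m 2 @ [1]))
    (conf 5 B (dn + (0 + m + 1)) 0 0 (O' @ replicate m 2 @ [1]))"
    by (rule reaches_mono[OF conf_next_block]) (use 0 in auto)
  ultimately have "reaches blowup_tm (Suc m * (2 * (Z + length B) + 2) + (2 * (Z + length B) + 2))
    (conf 5 B dn 0 (length B) O') (conf 5 B (dn + (0 + m + 1)) 0 0 (O' @ replicate m 2 @ [1]))"
    by (rule reaches_trans)
  then show ?case by (auto elim!: reaches_mono)
next
  case (Suc e)
  let ?O = "O' @ replicate m 2 @ [1]" and ?U = "2 * (Z + length B) + 2"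
  let ?end = "conf 5 B (dn + m + 1) 0 0 (?O @ concat (replicate (Suc e) (replicate m 2 @ [1])))"
  have eq: "Suc (length B - Suc e) = length B - e" using Suc.prems by simp
  have "reaches blowup_tm (Suc m * ?U) (conf 5 B dn 0 (length B - Suc e) O')
    (conf 9 B dn (0 + m + 1) (length B - Suc e) ?O)"
    using assms Suc.prems by (intro copy_block) auto
  moreover have "reaches blowup_tm ?U (conf 9 B dn (0 + m + 1) (length B - Suc e) ?O)
    (conf 5 B dn 0 (length B - e) ?O)"
    unfolding eq[symmetric] by (rule reaches_mono[OF conf_tally]) (use Suc.prems in auto)
  moreover have "reaches blowup_tm (Suc e * ((m + 2) * ?U)) (conf 5 B dn 0 (length B - e) ?O) ?end"
    using Suc.prems by (intro Suc.IH) auto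
  ultimately have "reaches blowup_tm (Suc m * ?U + (?U + Suc e * ((m + 2) * ?U)))
    (conf 5 B dn 0 (length B - Suc e) O') ?end"
    by (rule reaches_trans[OF _ reaches_trans])
  moreover have "Suc m * U + (U + Suc e * ((m + 2) * U)) = Suc (Suc e) * ((m + 2) * U)" for U
    by (simp add: algebra_simps)
  moreover have "?O @ concat (replicate (Suc e) (replicate m 2 @ [1]))
    = O' @ concat (replicate (Suc (Suc e)) (replicate m 2 @ [1]))" by simp
  ultimately show ?case by (simp only:)
qed

text \<open>A copy of the symbol \<open>a\<close> takes \<open>a + 3\<close> passes, one more than
  its code has cells; this explains the summand \<open>length X\<close>.\<close>

lemma blowup_symbols:
  assumes "B = pre @ enc_sym_string X @ post" "set O' \<subseteq> {1, 2, 4}"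
    "length O' + Suc (length B) * length (enc_sym_string X) \<le> Z"
  shows "reaches blowup_tm
    (Suc (length B) * ((length (enc_sym_string X) + length X) * (2 * (Z + length B) + 2)))
    (conf 5 B (length pre) 0 0 O')
    (conf 5 B (length pre + length (enc_sym_string X)) 0 0 (O' @ blowup_string (Suc (length B)) X))"
  using assms
proof (induction X arbitrary: pre O')
  case Nil
  then show ?case by (simp add: enc_sym_string_def blowup_string_def reaches_refl)
next
  case (Cons a X)
  let ?U = "2 * (Z + length B) + 2"
  let ?b = "replicate (a + 1) 2 @ [3::nat]"
  let ?c = "concat (replicate (Suc (length B)) (replicate (a + 1) 2 @ [1::nat]))"
  have enc: "enc_sym_string (a # X) = ?b @ enc_sym_string X" by (simp add: enc_sym_string_def)
  have B': "B = pre @ ?b @ enc_sym_string X @ post" using Cons.prems enc by simp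
  have lc: "length ?c = Suc (length B) * (a + 2)"
    by (simp add: length_concat sum_list_replicate)
  have "reaches blowup_tm (Suc (length B) * ((a + 1 + 2) * ?U))
    (conf 5 B (length pre) 0 (length B - length B) O')
    (conf 5 B (length pre + (a + 1) + 1) 0 0 (O' @ ?c))"
  proof (rule repeat_block)
    show "\<forall>i<a + 1. B ! (length pre + i) = 2"
      by (subst B') (simp add: nth_append del: replicate.simps)
    show "B ! (length pre + (a + 1)) = 3"
      by (subst B') (simp add: nth_append del: replicate.simps)
    show "length pre + (a + 1) < length B" by (subst B') simp
    show "length O' + Suc (length B) * (a + 1 + 1) \<le> Z"
      using Cons.prems(3) by (simp add: enc algebra_simps)
  qed (use Cons.prems in auto)
  moreover have "reaches blowup_tm
    (Suc (length B) * ((length (enc_sym_string X) + length X) * ?U))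
    (conf 5 B (length (pre @ ?b)) 0 0 (O' @ ?c))
    (conf 5 B (length (pre @ ?b) + length (enc_sym_string X)) 0 0 ((O' @ ?c) @ blowup_string (Suc (length B)) X))"
  proof (rule Cons.IH)
    show "B = (pre @ ?b) @ enc_sym_string X @ post" using B' by simp
    show "set (O' @ ?c) \<subseteq> {1, 2, 4}" using Cons.prems by auto
    show "length (O' @ ?c) + Suc (length B) * length (enc_sym_string X) \<le> Z"
      using Cons.prems(3) unfolding length_append lc by (simp add: enc algebra_simps)
  qed
  moreover have "length pre + (a + 1) + 1 = length (pre @ ?b)" by simp
  ultimately have "reaches blowup_tm (Suc (length B) * ((a + 1 + 2) * ?U) +
     Suc (length B) * ((length (enc_sym_string X) + length X) * ?U))
    (conf 5 B (length pre) 0 0 O')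
    (conf 5 B (length (pre @ ?b) + length (enc_sym_string X)) 0 0 ((O' @ ?c) @ blowup_string (Suc (length B)) X))"
    unfolding diff_self_eq_0 by (simp only: reaches_trans)
  moreover have "length (pre @ ?b) + length (enc_sym_string X) = length pre + length (enc_sym_string (a # X))"
    by (simp add: enc)
  moreover have "(O' @ ?c) @ blowup_string (Suc (length B)) X = O' @ blowup_string (Suc (length B)) (a # X)"
    by (simp add: blowup_string_def)
  moreover have "Suc (length B) * ((a + 1 + 2) * ?U) +
     Suc (length B) * ((length (enc_sym_string X) + length X) * ?U)
     = Suc (length B) * ((length (enc_sym_string (a # X)) + length (a # X)) * ?U)"
    unfolding add_mult_distrib2[symmetric] add_mult_distrib[symmetric] enc by (simp add: add.assoc)
  ultimately show ?case by (simp only:)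
qed

end

section \<open>Output and running time of the whole machine\<close>

lemma length_enc_sym_string: "2 * length X \<le> length (enc_sym_string X)"
  by (induction X) (simp_all add: enc_sym_string_def)

lemma set_enc_sym_string: "set (enc_sym_string X) \<subseteq> {2, 3}"
  by (auto simp: enc_sym_string_def)

lemma halts_with_blowup:
  fixes X Y :: "nat list"
  defines "L \<equiv> length (enc_input X Y)"
  obtains t where "t \<le> 8 * (L + 1) ^ 4"
    "halts_with blowup_tm (enc_input X Y) t (blowup_string (L + 1) X @ [4] @ blowup_string (L + 1) Y)"
proof -
  define B where "B = enc_input X Y"
  have B: "set B \<subseteq> {2, 3, 4}"
    using set_enc_sym_string[of X] set_enc_sym_string[of Y] by (auto simp: B_def enc_input_def)
  have L: "length B = L" by (simp add: B_def L_def)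
  let ?x = "length (enc_sym_string X)" and ?y = "length (enc_sym_string Y)"
  have Lxy: "L = ?x + 1 + ?y" by (simp add: L_def enc_input_def)
  \<comment> \<open>Bounds the final output, which consists of \<open>L + 1\<close> copies of the
    \<open>L - 1\<close> symbol cells and one separator.\<close>
  define Z where "Z = (L + 1) * L"
  define U where "U = 2 * (Z + L) + 2"
  have Z: "Suc L * ?x + 1 + Suc L * ?y \<le> Z" unfolding Z_def Lxy by (simp add: algebra_simps)
  let ?bX = "blowup_string (L + 1) X" and ?bY = "blowup_string (L + 1) Y"
  have sX: "set ?bX \<subseteq> {1, 2, 4}" and sY: "set ?bY \<subseteq> {1, 2, 4}"
    using set_blowup_string[of "L + 1"] by blast+
  have "reaches blowup_tm (4 * (L + 1)\<^sup>2) (init_config B) (conf 5 B 0 0 0 [])"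
    using start_conf[OF B] L by simp
  moreover have "reaches blowup_tm (Suc L * ((?x + length X) * U)) (conf 5 B 0 0 0 [])
    (conf 5 B ?x 0 0 ?bX)"
  proof -
    have "B = [] @ enc_sym_string X @ (4 # enc_sym_string Y)" by (simp add: B_def enc_input_def)
    from blowup_symbols[OF B this, of "[]" Z] L Z show ?thesis by (simp add: U_def)
  qed
  moreover have "reaches blowup_tm U (conf 5 B ?x 0 0 ?bX) (conf 5 B (?x + 1) 0 0 (?bX @ [4]))"
  proof (rule reaches_mono)
    show "reaches blowup_tm (2 * (length ?bX + length B) + 2) (conf 5 B ?x 0 0 ?bX)
      (conf 5 B (?x + 1) 0 0 (?bX @ [4]))"
      using conf_separator[OF B, of ?x ?bX 0] sX L Lxy by (simp add: B_def enc_input_def nth_append)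
    show "2 * (length ?bX + length B) + 2 \<le> U"
      using Z L by (simp add: U_def length_blowup_string)
  qed
  moreover have "reaches blowup_tm (Suc L * ((?y + length Y) * U)) (conf 5 B (?x + 1) 0 0 (?bX @ [4]))
    (conf 5 B L 0 0 (?bX @ [4] @ ?bY))"
  proof -
    have "B = (enc_sym_string X @ [4]) @ enc_sym_string Y @ []" by (simp add: B_def enc_input_def)
    moreover have "length (enc_sym_string X @ [4]) + ?y = L" by (simp add: Lxy)
    ultimately show ?thesis
      using blowup_symbols[OF B, of "enc_sym_string X @ [4]" Y "[]" "?bX @ [4]" Z] L Z sX
      by (simp add: U_def length_blowup_string)
  qed
  moreover have "reaches blowup_tm U (conf 5 B L 0 0 (?bX @ [4] @ ?bY)) (1, tape_of (?bX @ [4] @ ?bY), 0)"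
  proof (rule reaches_mono)
    show "reaches blowup_tm (2 * (length (?bX @ [4] @ ?bY) + length B) + 2)
      (conf 5 B L 0 0 (?bX @ [4] @ ?bY)) (1, tape_of (?bX @ [4] @ ?bY), 0)"
      using conf_finish[OF B, of "?bX @ [4] @ ?bY" 0] sX sY L by simp
    show "2 * (length (?bX @ [4] @ ?bY) + length B) + 2 \<le> U"
      using Z L by (simp add: U_def length_blowup_string)
  qed
  ultimately have "reaches blowup_tm (4 * (L + 1)\<^sup>2 + (Suc L * ((?x + length X) * U) +
      (U + (Suc L * ((?y + length Y) * U) + U)))) (init_config B) (1, tape_of (?bX @ [4] @ ?bY), 0)"
    by (meson reaches_trans)
  moreover have "4 * (L + 1)\<^sup>2 + (Suc L * ((?x + length X) * U) +
      (U + (Suc L * ((?y + length Y) * U) + U))) \<le> 8 * (L + 1) ^ 4"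
  proof -
    have U: "U = 2 * (L + 1)\<^sup>2" by (simp add: U_def Z_def power2_eq_square algebra_simps)
    have "?x + length X + (?y + length Y) + 1 \<le> 2 * L"
      using length_enc_sym_string[of X] length_enc_sym_string[of Y] Lxy by linarith
    then have "Suc L * (?x + length X + (?y + length Y)) + 2 \<le> 2 * (L + 1)\<^sup>2"
    proof -
      assume *: "?x + length X + (?y + length Y) + 1 \<le> 2 * L"
      have "Suc L * (?x + length X + (?y + length Y)) \<le> Suc L * (2 * L)"
        using * by (intro mult_le_mono2) simp
      then show ?thesis by (simp add: power2_eq_square algebra_simps)
    qed
    then have "(Suc L * (?x + length X + (?y + length Y)) + 2) * U \<le> 2 * (L + 1)\<^sup>2 * U"
      by (rule mult_le_mono1)
    moreover have "2 * (L + 1)\<^sup>2 * U = 4 * (L + 1) ^ 4"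
      unfolding U using power_add[of "L + 1" 2 2] by simp
    moreover have "(L + 1)\<^sup>2 \<le> (L + 1) ^ 4" by (rule power_increasing) simp_all
    moreover have "Suc L * ((?x + length X) * U) + (U + (Suc L * ((?y + length Y) * U) + U))
      = (Suc L * (?x + length X + (?y + length Y)) + 2) * U" by (simp add: algebra_simps)
    ultimately show ?thesis by linarith
  qed
  ultimately have "reaches blowup_tm (8 * (L + 1) ^ 4) (init_config B) (1, tape_of (?bX @ [4] @ ?bY), 0)"
    by (rule reaches_mono)
  then show thesis using that unfolding reaches_def halts_with_def B_def by fastforce
qed

subsection \<open>The reduction\<close>

definition code :: "nat \<Rightarrow> nat list \<Rightarrow> nat list" where
  "code N X = run_word (block_runs N X @ [0])"

text \<open>Identifies the machine's output with the word of runs used for the distance; the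
  trailing empty run contributes nothing.\<close>

lemma enc_bin_string_code: "enc_bin_string (code N X) = blowup_string N X"
proof -
  have "map Suc (zero_ended_runs (replicate n r)) = concat (replicate n (replicate r 2 @ [1]))" for n r
    by (induction n) (simp_all add: numeral_2_eq_2)
  then have "map Suc (zero_ended_runs (block_runs N X)) = blowup_string N X"
    by (induction X) (simp_all add: blowup_string_def)
  then show ?thesis by (simp add: code_def run_word_snoc enc_bin_string_def)
qed

lemma length_code: "length (code N X) = N * length (enc_sym_string X)"
  using arg_cong[OF enc_bin_string_code[of N X], of length]
  by (simp add: enc_bin_string_def length_blowup_string)

lemma binary_code: "binary (code N X)"
proof -
  have "Suc ` set (code N X) \<subseteq> {1, 2}"
    using set_blowup_string[of N X] by (simp add: enc_bin_string_code[symmetric] enc_bin_string_def)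
  then show ?thesis by (auto simp: binary_def)
qed

lemma length_enc_sym_string_le:
  "set X \<subseteq> {..<n} \<Longrightarrow> length (enc_sym_string X) \<le> length X * (n + 1)"
  by (induction X) (auto simp: enc_sym_string_def)

theorem theorem6p2:
  shows "\<exists>M c e. wf_tm M \<and>
    (\<forall>n X Y. length X = n \<and> length Y = n \<and> set X \<subseteq> {..<n} \<and> set Y \<subseteq> {..<n}
       \<and> compatible X Y \<longrightarrow>
       (\<exists>k x y. k \<le> c * (n + 1) ^ e \<and> halts_with M (enc_input X Y) k (enc_output x y)
          \<and> binary x \<and> binary y \<and> compatible x y
          \<and> length x \<le> c * (n + 1) ^ e \<and> D X Y = d x y))"
proof (rule exI[of _ blowup_tm], rule exI[of _ 128], rule exI[of _ 8], rule conjI[OF wf_blowup_tm],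
    intro allI impI, elim conjE)
  fix n and X Y :: "nat list"
  assume X: "length X = n" "set X \<subseteq> {..<n}" and Y: "length Y = n" "set Y \<subseteq> {..<n}"
    and comp: "compatible X Y"
  define L where "L = length (enc_input X Y)"
  define x y where "x = code (L + 1) X" and "y = code (L + 1) Y"
  have Lxy: "L = length (enc_sym_string X) + 1 + length (enc_sym_string Y)"
    by (simp add: L_def enc_input_def)
  have L_ge: "4 * n < L + 1"
    using length_enc_sym_string[of X] length_enc_sym_string[of Y] X Y Lxy by linarith
  have L_le: "L + 1 \<le> 2 * (n + 1) ^ 2"
  proof -
    have "L + 1 \<le> n * (n + 1) + n * (n + 1) + 2"
      using length_enc_sym_string_le[OF X(2)] length_enc_sym_string_le[OF Y(2)] X Y Lxy by simp
    then show ?thesis by (simp add: power2_eq_square algebra_simps)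
  qed
  \<comment> \<open>Source of the witnesses 128 and 8: the quadratic bound on \<open>L + 1\<close>
    is inserted into the running time.\<close>
  have L4: "8 * (L + 1) ^ 4 \<le> 128 * (n + 1) ^ 8"
  proof -
    have "(L + 1) ^ 4 \<le> (2 * (n + 1) ^ 2) ^ 4" using L_le by (rule power_mono) simp
    also have "\<dots> = 16 * (n + 1) ^ 8" by (simp add: power_mult_distrib flip: power_mult)
    finally show ?thesis by simp
  qed
  obtain t where t: "t \<le> 8 * (L + 1) ^ 4" "halts_with blowup_tm (enc_input X Y) t (enc_output x y)"
    using halts_with_blowup[of X Y] unfolding enc_output_def x_def y_def enc_bin_string_code L_def
    by blast
  have mXY: "mset X = mset Y" using comp by (simp add: compatible_def)
  \<comment> \<open>Lifted flips turn \<open>x\<close> into \<open>y\<close>, and flips preserve the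
    multiset.\<close>
  have "mset y = mset x"
    unfolding x_def y_def code_def
    using compatible_flips_within[OF mXY]
    by (intro mset_flips_within[OF flips_within_word[OF flips_within_block_runs]]) simp_all
  then have "compatible x y" by (simp add: compatible_def)
  moreover have "D X Y = d x y"
    unfolding d_def x_def y_def code_def using X Y mXY L_ge by (intro D_block_words) auto
  moreover have "length x \<le> 128 * (n + 1) ^ 8"
  proof -
    have "length x \<le> (L + 1) ^ 2"
      unfolding x_def length_code power2_eq_square using Lxy by (intro mult_le_mono2) simp
    also have "\<dots> \<le> (L + 1) ^ 4" by (rule power_increasing) simp_all
    finally show ?thesis using L4 by linarith
  qed
  ultimately show "\<exists>k x y. k \<le> 128 * (n + 1) ^ 8 \<and> halts_with blowup_tm (enc_input X Y) k (enc_output x y)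
      \<and> binary x \<and> binary y \<and> compatible x y
      \<and> length x \<le> 128 * (n + 1) ^ 8 \<and> D X Y = d x y"
    using t le_trans[OF t(1) L4] binary_code unfolding x_def y_def by blast
qed

end
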